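(* For every pricing policy $\mu=(\mu_t)_{t\ge 0}$ there exist parameters $A$ (a positive definite $24\times 24$ matrix), $b\in\mathbb{R}^{24}$, and a day-ahead dispatch sequence $(d^{DA}_t)_{t\ge 0}$ in $\mathbb{R}^{24}$ such that the cumulative regret grows at least at the rate of $\log T$; that is, there are constants $c>0$ and $T_0$ with $$\sum_{t=1}^{T} R_t^{\mu}\;\ge\; c\,\log T\qquad\text{for all } T\ge T_0 .$$
   Context: A retailer sets on each day $t=0,1,2,\dots$ a vector of 24 hourly retail prices $\pi_t\in\mathbb{R}^{24}$. On day $t$ there is a day-ahead dispatch vector $d^{DA}_t\in\mathbb{R}^{24}$, known to the retailer before the price is chosen. The realized (real-time) aggregate demand is $$d^{RT}_t=b-A\pi_t+w_t\in\mathbb{R}^{24},$$ where $b\in\mathbb{R}^{24}$ and the positive definite $24\times24$ matrix $A$ are deterministic, do not depend on $t$, and are unknown to the retailer. The noise vectors $w_t$, $t\ge 0$, are independent and identically distributed Gaussian random vectors with mean zero and covariance matrix $\Sigma_w\neq 0$, where $\Sigma_w$ is fixed. A (deterministic) pricing policy $\mu=(\mu_t)_{t\ge0}$ is a sequence of (measurable) mappings, not depending on $A,b$, that determines the price on day $t$ from past real-time consumption and the day-ahead dispatches up to day $t$: $$\pi_t^{\mu}=\mu_t\bigl(d^{RT}_0,\dots,d^{RT}_{t-1},\,d^{DA}_0,\dots,d^{DA}_{t-1},d^{DA}_t\bigr)\in\mathbb{R}^{24},$$ where the $d^{RT}_i$ are the demands generated under the prices $\pi_i^\mu$. The regret of $\mu$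 on day $t$ (the excess expected squared deviation of real-time demand from day-ahead dispatch over that of the optimal price $\pi_t^*=A^{-1}(b-d^{DA}_t)$ available when $A,b$ are known) is $$R_t^{\mu}=\mathbb{E}\bigl[\|b-A\pi_t^{\mu}-d^{DA}_t\|_2^2\bigr].$$ It depends on $\mu$, $A$, $b$, and $(d^{DA}_i)_{i\le t}$. *)

theory Defs
  imports "HOL-Probability.Probability"
begin

definition positive_definite :: "real^'n^'n \<Rightarrow> bool" where
  "positive_definite A \<longleftrightarrow> transpose A = A \<and> (\<forall>x. x \<noteq> 0 \<longrightarrow> 0 < x \<bullet> (A *v x))"

text \<open>A random vector is Gaussian if all its linear functionals are univariate normal.
  Degenerate (constant) functionals are allowed, so that the covariance matrix may be singular.\<close>

definition gaussian_vector :: "'a measure \<Rightarrow> ('a \<Rightarrow> real^'n) \<Rightarrow> bool" where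
  "gaussian_vector M X \<longleftrightarrow> X \<in> borel_measurable M \<and>
     (\<forall>u. (\<exists>m. AE \<omega> in M. u \<bullet> X \<omega> = m) \<or>
          (\<exists>m \<sigma>. 0 < \<sigma> \<and> distributed M lborel (\<lambda>\<omega>. u \<bullet> X \<omega>) (\<lambda>x. ennreal (normal_density m \<sigma> x))))"

definition mean_vector :: "'a measure \<Rightarrow> ('a \<Rightarrow> real^'n) \<Rightarrow> real^'n" where
  "mean_vector M X = (\<chi> i. \<integral>\<omega>. X \<omega> $ i \<partial>M)"

definition covariance_matrix :: "'a measure \<Rightarrow> ('a \<Rightarrow> real^'n) \<Rightarrow> real^'n^'n" where
  "covariance_matrix M X =
     (\<chi> i j. \<integral>\<omega>. (X \<omega> $ i - mean_vector M X $ i) * (X \<omega> $ j - mean_vector M X $ j) \<partial>M)"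

definition iid_gaussian_noise :: "'a measure \<Rightarrow> (nat \<Rightarrow> 'a \<Rightarrow> real^'n) \<Rightarrow> real^'n^'n \<Rightarrow> bool" where
  "iid_gaussian_noise M w S \<longleftrightarrow>
     prob_space.indep_vars M (\<lambda>_. borel) w UNIV \<and>
     (\<forall>t. distr M borel (w t) = distr M borel (w 0)) \<and>
     (\<forall>t. gaussian_vector M (w t) \<and> mean_vector M (w t) = 0 \<and> covariance_matrix M (w t) = S)"

text \<open>The day-\<open>t\<close> component of a policy takes the real-time demands of days \<open>0, \<dots>, t - 1\<close> and
  the day-ahead dispatches of days \<open>0, \<dots>, t\<close>, both as extensional functions on the index set.\<close>

type_synonym policy = "nat \<Rightarrow> (nat \<Rightarrow> real^24) \<Rightarrow> (nat \<Rightarrow> real^24) \<Rightarrow> real^24"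

definition pricing_policy :: "policy \<Rightarrow> bool" where
  "pricing_policy \<mu> \<longleftrightarrow>
     (\<forall>t. (\<lambda>(y, d). \<mu> t y d)
        \<in> borel_measurable ((\<Pi>\<^sub>M i\<in>{..<t}. borel) \<Otimes>\<^sub>M (\<Pi>\<^sub>M i\<in>{..t}. borel)))"

lemma restrict_fundef_cong [fundef_cong]:
  "I = J \<Longrightarrow> (\<And>i. i \<in> J \<Longrightarrow> f i = g i) \<Longrightarrow> restrict f I = restrict g J"
  by (auto simp: restrict_def)

text \<open>Below, \<open>d\<close> is the day-ahead dispatch sequence and \<open>e\<close> a single realization of the noise
  sequence.\<close>

fun real_time_demand ::
    "policy \<Rightarrow> real^24^24 \<Rightarrow> real^24 \<Rightarrow> (nat \<Rightarrow> real^24) \<Rightarrow> (nat \<Rightarrow> real^24) \<Rightarrow> nat \<Rightarrow> real^24" where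
  "real_time_demand \<mu> A b d e t =
     b - A *v \<mu> t (\<lambda>i\<in>{..<t}. real_time_demand \<mu> A b d e i) (\<lambda>i\<in>{..t}. d i) + e t"

declare real_time_demand.simps [simp del]

definition price ::
    "policy \<Rightarrow> real^24^24 \<Rightarrow> real^24 \<Rightarrow> (nat \<Rightarrow> real^24) \<Rightarrow> (nat \<Rightarrow> real^24) \<Rightarrow> nat \<Rightarrow> real^24" where
  "price \<mu> A b d e t = \<mu> t (\<lambda>i\<in>{..<t}. real_time_demand \<mu> A b d e i) (\<lambda>i\<in>{..t}. d i)"

lemma real_time_demand_eq:
  "real_time_demand \<mu> A b d e t = b - A *v price \<mu> A b d e t + e t"
  by (subst real_time_demand.simps) (simp add: price_def)

text \<open>The regret is a nonnegative, possibly infinite expectation, since a policy need not produce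
  square-integrable prices; hence it takes values in the extended nonnegative reals.\<close>

definition regret ::
    "'a measure \<Rightarrow> (nat \<Rightarrow> 'a \<Rightarrow> real^24) \<Rightarrow> policy \<Rightarrow> real^24^24 \<Rightarrow> real^24
      \<Rightarrow> (nat \<Rightarrow> real^24) \<Rightarrow> nat \<Rightarrow> ennreal" where
  "regret M w \<mu> A b d t =
     (\<integral>\<^sup>+\<omega>. ennreal ((norm (b - A *v price \<mu> A b d (\<lambda>s. w s \<omega>) t - d t))\<^sup>2) \<partial>M)"

end

theory Submission imports Defs begin

text \<open>With \<open>A = mat 1\<close> and \<open>d = 0\<close> the price of day \<open>t\<close> is a function of
  \<open>b + w\<^sub>0, \<dots>, b + w\<^bsub>t-1\<^esub>\<close>, and the regret is its mean squared error as an
  estimator of \<open>b\<close>. Only the direction \<open>v\<close> of a nonzero column of the covariance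
  matrix is used: a shift of the noise along \<open>v\<close> has an explicit density (even if the covariance is
  singular), so that, by a \<open>\<chi>\<^sup>2\<close> bound, samples of size \<open>t\<close> from \<open>b = \<theta> v\<close> and
  \<open>b = \<theta>' v\<close> are hard to tell apart when \<open>\<bar>\<theta> - \<theta>'\<bar>\<close> is small compared with \<open>1 / sqrt t\<close>.

  A single \<open>\<theta>\<close> that is bad for all horizons is found by successive choices: at scale \<open>g\<close> one of two
  candidates at distance \<open>\<delta>\<^sub>g = const / 8 ^ g\<close> has an error of at least \<open>\<delta>\<^sub>g * norm v / 2\<close> with
  probability at least \<open>1 / 4\<close>, averaged over the days in \<open>{64 ^ g<..2 * 64 ^ g}\<close>, and the later corrections, of total size at most \<open>\<delta>\<^sub>g / 7\<close>, are
  too small to be noticed within that block. Each block thus contributes a constant to the regret.\<close>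

subsection \<open>Characteristic functions on Euclidean spaces\<close>

text \<open>Divided by its total mass, the weight \<open>g\<close> is a probability density; pushing
  it forward along \<open>f\<close> gives real distributions whose characteristic functions agree by
  \<open>eq\<close>, so Levy's uniqueness theorem applies. A weight of mass zero cannot be
  normalised and is treated apart.\<close>

lemma integral_indicator_eq_of_weighted_char_eq:
  fixes M N :: "'a::euclidean_space measure" and f g :: "'a \<Rightarrow> real"
  assumes "prob_space M" "prob_space N"
    and sets[measurable_cong]: "sets M = sets borel" "sets N = sets borel"
    and f[measurable]: "f \<in> borel_measurable borel"
    and g[measurable]: "g \<in> borel_measurable borel" and g_bounds: "\<And>x. 0 \<le> g x" "\<And>x. g x \<le> C"
    and eq: "\<And>l. (\<integral>x. g x *\<^sub>R cis (l * f x) \<partial>M) = (\<integral>x. g x *\<^sub>R cis (l * f x) \<partial>N)"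
    and B[measurable]: "B \<in> sets borel"
  shows "(\<integral>x. g x * indicator B (f x) \<partial>M) = (\<integral>x. g x * indicator B (f x) \<partial>N)"
proof -
  define m where "m = (\<integral>x. g x \<partial>M)"
  have int: "integrable K g" if "prob_space K" and [measurable_cong]: "sets K = sets borel"
    for K :: "'a measure"
  proof -
    interpret prob_space K by fact
    show ?thesis using g_bounds by (intro integrable_const_bound[where B=C]) auto
  qed
  \<comment> \<open>Frequency \<open>l = 0\<close> in \<open>eq\<close> compares the total
    masses.\<close>
  have mN: "(\<integral>x. g x \<partial>N) = m"
  proof -
    have "complex_of_real (\<integral>x. g x \<partial>N) = complex_of_real m"
      using eq[of 0] by (simp add: m_def scaleR_conv_of_real)
    then show ?thesis by (simp only: of_real_eq_iff)
  qed
  show ?thesis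
  proof (cases "m = 0")
    case True
    have "(\<integral>x. g x * indicator B (f x) \<partial>K) = 0"
      if K: "prob_space K" "sets K = sets borel" "(\<integral>x. g x \<partial>K) = 0" for K :: "'a measure"
    proof -
      have "AE x in K. g x = 0"
        using K integral_nonneg_eq_0_iff_AE[OF int[OF K(1,2)]] g_bounds by auto
      then show ?thesis by (intro integral_eq_zero_AE) auto
    qed
    from this[OF assms(1) sets(1)] this[OF assms(2) sets(2)] True mN show ?thesis
      by (simp add: m_def)
  next
    case False
    then have m: "0 < m"
      using g_bounds by (simp add: m_def order_less_le integral_nonneg)
    define D where "D K = distr (density K (\<lambda>x. ennreal (g x / m))) borel f" for K :: "'a measure"
    have D: "real_distribution (D K)"
      "\<And>l. char (D K) l = (\<integral>x. g x *\<^sub>R cis (l * f x) \<partial>K) / m"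
      "measure (D K) B = (\<integral>x. g x * indicator B (f x) \<partial>K) / m"
      if K: "prob_space K" and K'[measurable_cong]: "sets K = sets borel" "(\<integral>x. g x \<partial>K) = m"
      for K :: "'a measure"
    proof -
      interpret prob_space K by fact
      have "emeasure (density K (\<lambda>x. ennreal (g x / m))) (space K) = (\<integral>\<^sup>+x. ennreal (g x / m) \<partial>K)"
        by (subst emeasure_density) (auto intro!: nn_integral_cong)
      also have "\<dots> = ennreal (\<integral>x. g x / m \<partial>K)"
        using m g_bounds int[OF K K'(1)] by (intro nn_integral_eq_integral) auto
      also have "\<dots> = 1" using m K' by simp
      finally have pd: "prob_space (density K (\<lambda>x. ennreal (g x / m)))"
        by (intro prob_spaceI) simp
      show "real_distribution (D K)"
        unfolding D_def using pd
        by (intro prob_space.real_distribution_distr) auto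
      show "char (D K) l = (\<integral>x. g x *\<^sub>R cis (l * f x) \<partial>K) / m" for l
      proof -
        have "char (D K) l = (\<integral>x. (g x / m) *\<^sub>R cis (l * f x) \<partial>K)"
          unfolding char_def D_def using m g_bounds
          by (simp add: integral_distr integral_density cis_conv_exp)
        also have "\<dots> = (\<integral>x. inverse m *\<^sub>R (g x *\<^sub>R cis (l * f x)) \<partial>K)"
          by (simp add: divide_inverse mult.commute)
        also have "\<dots> = (\<integral>x. g x *\<^sub>R cis (l * f x) \<partial>K) / m"
          by (subst integral_scaleR_right) (simp add: scaleR_conv_of_real divide_inverse)
        finally show ?thesis .
      qed
      have "measure (D K) B = (\<integral>x. indicator B x \<partial>D K)"
        by (simp add: D_def)
      also have "\<dots> = (\<integral>x. g x / m * indicator B (f x) \<partial>K)"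
        unfolding D_def using m g_bounds
        by (subst integral_distr, simp, simp, subst integral_density) auto
      also have "\<dots> = (\<integral>x. g x * indicator B (f x) \<partial>K) / m"
        by simp
      finally show "measure (D K) B = (\<integral>x. g x * indicator B (f x) \<partial>K) / m" .
    qed
    note DM = D[OF assms(1) sets(1) m_def[symmetric]] and DN = D[OF assms(2) sets(2) mN]
    have "char (D M) = char (D N)"
      by (rule ext) (simp add: DM(2) DN(2) eq)
    then have "D M = D N" by (intro Levy_uniqueness DM DN)
    then show ?thesis using DM(3) DN(3) m by simp
  qed
qed

text \<open>Built from the one-dimensional uniqueness theorem: indicators of single coordinates are
  inserted one at a time, while characters in all directions are carried along.\<close>

lemma char_eq_imp_measure_eq:
  fixes M N :: "'a::euclidean_space measure"
  assumes "prob_space M" "prob_space N"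
    and sets[measurable_cong]: "sets M = sets borel" "sets N = sets borel"
    and eq: "\<And>s. (\<integral>x. cis (s \<bullet> x) \<partial>M) = (\<integral>x. cis (s \<bullet> x) \<partial>N)"
  shows "M = N"
proof -
  interpret M: prob_space M by fact
  interpret N: prob_space N by fact
  \<comment> \<open>The character keeps an arbitrary \<open>s\<close>, because the step for a new
    coordinate calls the hypothesis at frequencies other than \<open>s\<close>.\<close>
  have main: "(\<integral>x. (\<Prod>i\<in>I. indicator (A i) (x \<bullet> i)) *\<^sub>R cis (s \<bullet> x) \<partial>M)
      = (\<integral>x. (\<Prod>i\<in>I. indicator (A i) (x \<bullet> i)) *\<^sub>R cis (s \<bullet> x) \<partial>N)"
    if "finite I" and A: "\<And>i. A i \<in> sets borel" for I A s
    using \<open>finite I\<close>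
  proof (induction I arbitrary: s)
    case empty
    then show ?case by (simp add: eq)
  next
    case (insert i I)
    note A[measurable]
    define h :: "'a \<Rightarrow> real" where "h x = (\<Prod>i\<in>I. indicator (A i) (x \<bullet> i))" for x
    have h[measurable]: "h \<in> borel_measurable borel"
      unfolding h_def by measurable
    have h_bounds: "0 \<le> h x" "h x \<le> 1" for x
      by (auto simp: h_def prod_nonneg indicator_def intro!: prod_le_1)
    have intc: "integrable M (\<lambda>x. h x *\<^sub>R cis (t \<bullet> x))" "integrable N (\<lambda>x. h x *\<^sub>R cis (t \<bullet> x))" for t
      using h_bounds
      by (auto intro!: M.integrable_const_bound[where B=1] N.integrable_const_bound[where B=1]
        borel_measurable_continuous_onI continuous_intros simp: cis_conv_exp)
    have IH: "(\<integral>x. h x *\<^sub>R cis (t \<bullet> x) \<partial>M) = (\<integral>x. h x *\<^sub>R cis (t \<bullet> x) \<partial>N)" for t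
      unfolding h_def by (rule insert.IH)
    \<comment> \<open>Levy's theorem only applies to nonnegative weights, hence the shift by \<open>1\<close>.\<close>
    have step: "(\<integral>x. (h x * (1 + Re (z * cis (s \<bullet> x)))) * indicator (A i) (x \<bullet> i) \<partial>M)
      = (\<integral>x. (h x * (1 + Re (z * cis (s \<bullet> x)))) * indicator (A i) (x \<bullet> i) \<partial>N)"
      if z: "cmod z \<le> 1" for z
    proof (rule integral_indicator_eq_of_weighted_char_eq[where C=2])
      have b: "\<bar>Re (z * cis (s \<bullet> x))\<bar> \<le> 1" for x
        using abs_Re_le_cmod[of "z * cis (s \<bullet> x)"] z by (simp add: norm_mult del: times_complex.sel)
      show "0 \<le> h x * (1 + Re (z * cis (s \<bullet> x)))" for x
        using h_bounds[of x] b[of x] by (intro mult_nonneg_nonneg) auto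
      show "h x * (1 + Re (z * cis (s \<bullet> x))) \<le> 2" for x
        using mult_mono[OF h_bounds(2)[of x], of "1 + Re (z * cis (s \<bullet> x))" 2] h_bounds[of x] b[of x]
        by auto
      show "(\<lambda>x. h x * (1 + Re (z * cis (s \<bullet> x)))) \<in> borel_measurable borel"
        by (auto simp: cis.ctr)
      fix l
      \<comment> \<open>Splitting the real part into a character and its conjugate leaves three
        characters, of frequencies \<open>l *\<^sub>R i\<close>, \<open>s + l *\<^sub>R i\<close>
        and \<open>l *\<^sub>R i - s\<close>; the induction hypothesis covers each.\<close>
      have e: "(h x * (1 + Re (z * cis (s \<bullet> x)))) *\<^sub>R cis (l * (x \<bullet> i))
        = h x *\<^sub>R cis ((l *\<^sub>R i) \<bullet> x) + (z / 2) * (h x *\<^sub>R cis ((s + l *\<^sub>R i) \<bullet> x))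
          + (cnj z / 2) * (h x *\<^sub>R cis ((l *\<^sub>R i - s) \<bullet> x))" for x
      proof -
        have c: "complex_of_real (Re w) = (w + cnj w) / 2" for w
          by (simp add: complex_eq_iff)
        have "complex_of_real (1 + Re (z * cis (s \<bullet> x))) * cis (l * (x \<bullet> i))
           = cis (l * (x \<bullet> i)) + (z / 2) * (cis (s \<bullet> x) * cis (l * (x \<bullet> i)))
            + (cnj z / 2) * (cis (- (s \<bullet> x)) * cis (l * (x \<bullet> i)))"
          unfolding of_real_add c by (simp add: cis_cnj field_simps)
        also have "\<dots> = cis (l * (x \<bullet> i)) + (z / 2) * cis (s \<bullet> x + l * (x \<bullet> i))
            + (cnj z / 2) * cis (l * (x \<bullet> i) - s \<bullet> x)"
          by (simp add: cis_mult)
        finally have "of_real (h x) * (complex_of_real (1 + Re (z * cis (s \<bullet> x))) * cis (l * (x \<bullet> i)))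
          = of_real (h x) * (cis (l * (x \<bullet> i)) + (z / 2) * cis (s \<bullet> x + l * (x \<bullet> i))
            + (cnj z / 2) * cis (l * (x \<bullet> i) - s \<bullet> x))" by simp
        then show ?thesis
          unfolding scaleR_conv_of_real of_real_mult
          by (simp add: inner_add_left inner_diff_left inner_commute[of x i]
              ring_distribs mult_ac del: of_real_add times_complex.sel)
      qed
      show "(\<integral>x. (h x * (1 + Re (z * cis (s \<bullet> x)))) *\<^sub>R cis (l * (x \<bullet> i)) \<partial>M) =
            (\<integral>x. (h x * (1 + Re (z * cis (s \<bullet> x)))) *\<^sub>R cis (l * (x \<bullet> i)) \<partial>N)"
        unfolding e
        by (simp only: Bochner_Integration.integral_add Bochner_Integration.integrable_add
            integrable_mult_right integral_mult_right_zero intc IH)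
    qed (use assms A in auto)
    have trig_bounds: "h x * \<bar>cos t\<bar> \<le> 1" "h x * \<bar>sin t\<bar> \<le> 1" for x t
      using h_bounds by (auto intro!: mult_le_one)
    have intr: "integrable M (\<lambda>x. h x * indicator (A i) (x \<bullet> i))" "integrable N (\<lambda>x. h x * indicator (A i) (x \<bullet> i))"
      "integrable M (\<lambda>x. h x * indicator (A i) (x \<bullet> i) * cos (s \<bullet> x))"
      "integrable N (\<lambda>x. h x * indicator (A i) (x \<bullet> i) * cos (s \<bullet> x))"
      "integrable M (\<lambda>x. h x * indicator (A i) (x \<bullet> i) * sin (s \<bullet> x))"
      "integrable N (\<lambda>x. h x * indicator (A i) (x \<bullet> i) * sin (s \<bullet> x))"
      using h_bounds trig_bounds
      by (auto intro!: M.integrable_const_bound[where B=1] N.integrable_const_bound[where B=1]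
         simp: abs_mult split: split_indicator)
    let ?g = "\<lambda>x. h x * indicator (A i) (x \<bullet> i)"
    \<comment> \<open>The values \<open>z = 0\<close>, \<open>1\<close> and \<open>-\<i>\<close>
      make the factor next to \<open>h x\<close> equal to \<open>1\<close>,
      \<open>1 + cos (s \<bullet> x)\<close> and \<open>1 + sin (s \<bullet> x)\<close>; subtraction
      isolates the real and imaginary parts.\<close>
    have 0: "(\<integral>x. ?g x \<partial>M) = (\<integral>x. ?g x \<partial>N)"
      using step[of 0] by simp
    have 1: "(\<integral>x. ?g x * cos (s \<bullet> x) \<partial>M) = (\<integral>x. ?g x * cos (s \<bullet> x) \<partial>N)"
    proof -
      have "(\<integral>x. ?g x + ?g x * cos (s \<bullet> x) \<partial>M) = (\<integral>x. ?g x + ?g x * cos (s \<bullet> x) \<partial>N)"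
        using step[of 1] by (simp add: algebra_simps)
      then show ?thesis using 0 intr by simp
    qed
    have 2: "(\<integral>x. ?g x * sin (s \<bullet> x) \<partial>M) = (\<integral>x. ?g x * sin (s \<bullet> x) \<partial>N)"
    proof -
      have "(\<integral>x. ?g x + ?g x * sin (s \<bullet> x) \<partial>M) = (\<integral>x. ?g x + ?g x * sin (s \<bullet> x) \<partial>N)"
        using step[of "-\<i>"] by (simp add: algebra_simps)
      then show ?thesis using 0 intr by simp
    qed
    have dec: "(\<integral>x. ?g x *\<^sub>R cis (s \<bullet> x) \<partial>K)
      = of_real (\<integral>x. ?g x * cos (s \<bullet> x) \<partial>K) + \<i> * of_real (\<integral>x. ?g x * sin (s \<bullet> x) \<partial>K)"
      if "integrable K (\<lambda>x. ?g x * cos (s \<bullet> x))" "integrable K (\<lambda>x. ?g x * sin (s \<bullet> x))"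
      for K :: "'a measure"
    proof -
      have "(\<integral>x. ?g x *\<^sub>R cis (s \<bullet> x) \<partial>K)
        = (\<integral>x. of_real (?g x * cos (s \<bullet> x)) + \<i> * of_real (?g x * sin (s \<bullet> x)) \<partial>K)"
        by (intro Bochner_Integration.integral_cong refl) (simp add: complex_eq_iff)
      also have "\<dots> = of_real (\<integral>x. ?g x * cos (s \<bullet> x) \<partial>K) + \<i> * of_real (\<integral>x. ?g x * sin (s \<bullet> x) \<partial>K)"
        using that by (simp del: of_real_mult)
      finally show ?thesis .
    qed
    have "(\<integral>x. ?g x *\<^sub>R cis (s \<bullet> x) \<partial>M) = (\<integral>x. ?g x *\<^sub>R cis (s \<bullet> x) \<partial>N)"
      by (simp only: dec[OF intr(3,5)] dec[OF intr(4,6)] 1 2)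
    then show ?case using insert.hyps by (simp add: h_def mult.commute)
  qed
  \<comment> \<open>At \<open>s = 0\<close> the character disappears, and the product over
    \<open>Basis\<close> becomes the indicator of an open box. Open boxes are an intersection-stable
    generator of the Borel sets.\<close>
  have box: "measure M (box a b) = measure N (box a b)" for a b
  proof -
    have ind: "(\<Prod>i\<in>Basis. indicator {a \<bullet> i<..<b \<bullet> i} (x \<bullet> i)) = (indicator (box a b) x :: real)" for x
      by (auto simp: indicator_def mem_box prod_zero_iff)
    have "complex_of_real (measure M (box a b)) = complex_of_real (measure N (box a b))"
      using main[of Basis "\<lambda>i. {a \<bullet> i<..<b \<bullet> i}" 0]
      by (simp add: ind scaleR_conv_of_real sets_eq_imp_space_eq[OF sets(1)] sets_eq_imp_space_eq[OF sets(2)])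
    then show ?thesis by simp
  qed
  let ?E = "range (\<lambda>(a, b). box a b::'a set)"
  show "M = N"
  proof (rule measure_eqI_generator_eq[where E="?E" and A="\<lambda>n. box (- (real n *\<^sub>R One)) (real n *\<^sub>R One)" and \<Omega>=UNIV])
    show "Int_stable ?E" by (auto simp: Int_stable_def box_Int_box)
    show "sets M = sigma_sets UNIV ?E" "sets N = sigma_sets UNIV ?E"
      by (simp_all add: sets borel_eq_box)
    show "\<Union>(range (\<lambda>n. box (- (real n *\<^sub>R One)) (real n *\<^sub>R One))) = (UNIV::'a set)"
      using UN_box_eq_UNIV by auto
  qed (auto simp: M.emeasure_eq_measure N.emeasure_eq_measure box)
qed

subsection \<open>Shifts of possibly degenerate Gaussian vectors\<close>

locale centered_gaussian = prob_space M for M :: "'a measure" +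
  fixes X :: "'a \<Rightarrow> 'b::euclidean_space"
  assumes X[measurable]: "X \<in> borel_measurable M"
    and functional: "\<And>u. (AE \<omega> in M. u \<bullet> X \<omega> = 0) \<or>
      (\<exists>\<sigma>>0. distributed M lborel (\<lambda>\<omega>. u \<bullet> X \<omega>) (\<lambda>x. ennreal (normal_density 0 \<sigma> x)))"
begin

lemma integrable_square: "integrable M (\<lambda>\<omega>. (u \<bullet> X \<omega>)\<^sup>2)"
  using functional[of u]
proof
  assume "AE \<omega> in M. u \<bullet> X \<omega> = 0"
  then show ?thesis
    by (subst integrable_cong_AE[where g="\<lambda>_. 0"]) auto
next
  assume "\<exists>\<sigma>>0. distributed M lborel (\<lambda>\<omega>. u \<bullet> X \<omega>) (\<lambda>x. ennreal (normal_density 0 \<sigma> x))"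
  then obtain \<sigma> where s: "\<sigma> > 0" and d: "distributed M lborel (\<lambda>\<omega>. u \<bullet> X \<omega>) (\<lambda>x. ennreal (normal_density 0 \<sigma> x))"
    by auto
  show ?thesis
    using distributed_integrable[OF d, of "\<lambda>x. x\<^sup>2"] integrable_normal_moment[OF s, of 0 2] by simp
qed

lemma integrable_product: "integrable M (\<lambda>\<omega>. (u \<bullet> X \<omega>) * (v \<bullet> X \<omega>))"
proof -
  have "(\<lambda>\<omega>. (u \<bullet> X \<omega>) * (v \<bullet> X \<omega>)) = (\<lambda>\<omega>. (((u + v) \<bullet> X \<omega>)\<^sup>2 - ((u - v) \<bullet> X \<omega>)\<^sup>2) / 4)"
    by (auto simp: fun_eq_iff inner_simps power2_eq_square field_simps)
  then show ?thesis by (simp add: integrable_square)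
qed

text \<open>Expressed through the second moment, the formula is the same for degenerate and
  nondegenerate functionals, so factorising characters reduces to computing second moments.\<close>

lemma char_functional: "(\<integral>\<omega>. cis (u \<bullet> X \<omega>) \<partial>M) = exp (- expectation (\<lambda>\<omega>. (u \<bullet> X \<omega>)\<^sup>2) / 2)"
  using functional[of u]
proof
  assume ae: "AE \<omega> in M. u \<bullet> X \<omega> = 0"
  have "(\<integral>\<omega>. cis (u \<bullet> X \<omega>) \<partial>M) = (\<integral>\<omega>. 1 \<partial>M)"
    using ae by (intro integral_cong_AE) (auto simp: cis_conv_exp)
  moreover have "expectation (\<lambda>\<omega>. (u \<bullet> X \<omega>)\<^sup>2) = 0"
    using ae by (intro integral_eq_zero_AE) auto
  ultimately show ?thesis by (simp add: prob_space)
next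
  assume "\<exists>\<sigma>>0. distributed M lborel (\<lambda>\<omega>. u \<bullet> X \<omega>) (\<lambda>x. ennreal (normal_density 0 \<sigma> x))"
  then obtain \<sigma> where s: "\<sigma> > 0" and d: "distributed M lborel (\<lambda>\<omega>. u \<bullet> X \<omega>) (\<lambda>x. ennreal (normal_density 0 \<sigma> x))"
    by auto
  have v: "expectation (\<lambda>\<omega>. (u \<bullet> X \<omega>)\<^sup>2) = \<sigma>\<^sup>2"
    using normal_distributed_variance[OF s d] normal_distributed_expectation[OF s d] by simp
  \<comment> \<open>Dividing by \<sigma> reduces to the standard normal law, whose characteristic
    function is then evaluated at \<sigma>.\<close>
  have "distributed M lborel (\<lambda>\<omega>. (u \<bullet> X \<omega> - 0) / \<sigma>) (\<lambda>x. ennreal (std_normal_density x))"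
    using normal_standard_normal_convert[OF s, of "\<lambda>\<omega>. u \<bullet> X \<omega>" 0] d by simp
  then have "distr M lborel (\<lambda>\<omega>. u \<bullet> X \<omega> / \<sigma>) = std_normal_distribution"
    by (simp add: distributed_def)
  moreover have "distr M lborel (\<lambda>\<omega>. u \<bullet> X \<omega> / \<sigma>) = distr M borel (\<lambda>\<omega>. u \<bullet> X \<omega> / \<sigma>)"
    by (intro distr_cong) auto
  ultimately have "char (distr M borel (\<lambda>\<omega>. u \<bullet> X \<omega> / \<sigma>)) \<sigma> = exp (- (\<sigma>\<^sup>2) / 2)"
    using char_std_normal_distribution by simp
  moreover have "char (distr M borel (\<lambda>\<omega>. u \<bullet> X \<omega> / \<sigma>)) \<sigma> = (\<integral>\<omega>. cis (u \<bullet> X \<omega>) \<partial>M)"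
    unfolding char_def using s by (subst integral_distr) (auto simp: cis_conv_exp)
  ultimately show ?thesis using v by simp
qed

end

text \<open>\<open>v\<close> is the regression coefficient of \<open>X\<close> on the functional \<open>a \<bullet> X\<close>.\<close>

locale gaussian_regression = centered_gaussian M X
  for M :: "'a measure" and X :: "'a \<Rightarrow> 'b::euclidean_space" +
  fixes a v :: 'b and q :: real
  assumes q_pos: "0 < q"
    and variance_a: "expectation (\<lambda>\<omega>. (a \<bullet> X \<omega>)\<^sup>2) = q"
    and regression: "\<And>s. expectation (\<lambda>\<omega>. (a \<bullet> X \<omega>) * (s \<bullet> X \<omega>)) = q * (s \<bullet> v)"
begin

definition "Y \<omega> = a \<bullet> X \<omega>"
text \<open>The residual of the regression: it is uncorrelated with \<open>Y\<close>, hence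
  independent of it by Gaussianity. Adding a multiple of \<open>v\<close> to \<open>X\<close> can
  thus be read as translating \<open>Y\<close> with \<open>Z\<close> held fixed.\<close>

definition "Z \<omega> = X \<omega> - Y \<omega> *\<^sub>R v"

lemma measurable_YZ[measurable]: "Y \<in> borel_measurable M" "Z \<in> borel_measurable M"
  by (simp_all add: Y_def[abs_def] Z_def[abs_def])

lemma char_YZ:
  "(\<integral>\<omega>. cis (l * Y \<omega> + s \<bullet> Z \<omega>) \<partial>M) = (\<integral>\<omega>. cis (l * Y \<omega>) \<partial>M) * (\<integral>\<omega>. cis (s \<bullet> Z \<omega>) \<partial>M)"
proof -
  \<comment> \<open>Chosen so that \<open>s \<bullet> Z \<omega> = r \<bullet> X \<omega>\<close>.
    The covariance of \<open>a \<bullet> X\<close> and \<open>r \<bullet> X\<close> is then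
    \<open>q * (s \<bullet> v) - (s \<bullet> v) * q = 0\<close>, which removes the cross term from
    the second moment.\<close>
  define r where "r = s - (s \<bullet> v) *\<^sub>R a"
  have Z: "s \<bullet> Z \<omega> = r \<bullet> X \<omega>" for \<omega>
    by (simp add: Z_def Y_def r_def inner_simps)
  have Y: "l * Y \<omega> = (l *\<^sub>R a) \<bullet> X \<omega>" for \<omega>
    by (simp add: Y_def)
  have YZ: "l * Y \<omega> + s \<bullet> Z \<omega> = (l *\<^sub>R a + r) \<bullet> X \<omega>" for \<omega>
    by (simp add: Z Y inner_simps)
  have "expectation (\<lambda>\<omega>. (a \<bullet> X \<omega>) * (r \<bullet> X \<omega>))
    = expectation (\<lambda>\<omega>. (a \<bullet> X \<omega>) * (s \<bullet> X \<omega>) - (s \<bullet> v) * (a \<bullet> X \<omega>)\<^sup>2)"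
    by (simp add: r_def inner_simps power2_eq_square algebra_simps)
  also have "\<dots> = 0"
    by (simp add: integrable_product integrable_square regression variance_a)
  finally have 0: "expectation (\<lambda>\<omega>. (a \<bullet> X \<omega>) * (r \<bullet> X \<omega>)) = 0" .
  have "expectation (\<lambda>\<omega>. ((l *\<^sub>R a + r) \<bullet> X \<omega>)\<^sup>2)
    = expectation (\<lambda>\<omega>. ((l *\<^sub>R a) \<bullet> X \<omega>)\<^sup>2 + (r \<bullet> X \<omega>)\<^sup>2 + 2 * l * ((a \<bullet> X \<omega>) * (r \<bullet> X \<omega>)))"
    by (intro Bochner_Integration.integral_cong refl) (simp add: inner_simps power2_eq_square algebra_simps)
  also have "\<dots> = expectation (\<lambda>\<omega>. ((l *\<^sub>R a) \<bullet> X \<omega>)\<^sup>2) + expectation (\<lambda>\<omega>. (r \<bullet> X \<omega>)\<^sup>2)"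
    by (simp add: integrable_product integrable_square 0 del: inner_scaleR_left)
  finally show ?thesis
    unfolding YZ unfolding Y Z char_functional
    by (simp only: of_real_mult[symmetric] exp_add[symmetric] minus_add_distrib add_divide_distrib)
qed

text \<open>Independence of \<open>Y\<close> and \<open>Z\<close>: by \<open>char_YZ\<close> the
  joint characteristic function is that of the product measure, and characteristic functions
  determine the measure.\<close>

lemma law_YZ:
  "distr M borel (\<lambda>\<omega>. (Y \<omega>, Z \<omega>)) = distr M borel Y \<Otimes>\<^sub>M distr M borel Z"
proof (rule char_eq_imp_measure_eq)
  interpret LY: prob_space "distr M borel Y" by (rule prob_space_distr) simp
  interpret LZ: prob_space "distr M borel Z" by (rule prob_space_distr) simp
  interpret P: pair_prob_space "distr M borel Y" "distr M borel Z" ..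
  show "prob_space (distr M borel Y \<Otimes>\<^sub>M distr M borel Z)"
    by (rule P.P.prob_space_axioms)
  show "prob_space (distr M borel (\<lambda>\<omega>. (Y \<omega>, Z \<omega>)))"
    by (rule prob_space_distr) simp
  show S: "sets (distr M borel Y \<Otimes>\<^sub>M distr M borel Z) = sets borel"
    by (subst sets_pair_measure_cong[of _ borel _ borel]) (simp_all add: borel_prod cong del: sets_pair_measure_cong)
  fix s :: "real \<times> 'b"
  have m: "(\<lambda>x. cis (s \<bullet> x)) \<in> borel_measurable borel"
    by (auto simp: cis_conv_exp intro!: borel_measurable_continuous_onI continuous_intros)
  have m': "(\<lambda>x. cis (s \<bullet> x)) \<in> borel_measurable (distr M borel Y \<Otimes>\<^sub>M distr M borel Z)"
    using m by (simp add: measurable_cong_sets[OF S refl])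
  have "(\<integral>x. cis (s \<bullet> x) \<partial>(distr M borel Y \<Otimes>\<^sub>M distr M borel Z))
     = (\<integral>y. \<integral>z. cis (s \<bullet> (y, z)) \<partial>distr M borel Z \<partial>distr M borel Y)"
    using P.integral_fst'[of "\<lambda>x. cis (s \<bullet> x)"] P.P.integrable_const_bound[of "\<lambda>x. cis (s \<bullet> x)" 1] m'
    by simp
  also have "\<dots> = (\<integral>y. cis (fst s * y) * (\<integral>z. cis (snd s \<bullet> z) \<partial>distr M borel Z) \<partial>distr M borel Y)"
    by (cases s) (simp add: inner_prod_def flip: cis_mult)
  also have "\<dots> = (\<integral>y. cis (fst s * y) \<partial>distr M borel Y) * (\<integral>z. cis (snd s \<bullet> z) \<partial>distr M borel Z)"
    by simp
  also have "\<dots> = (\<integral>\<omega>. cis (fst s * Y \<omega>) \<partial>M) * (\<integral>\<omega>. cis (snd s \<bullet> Z \<omega>) \<partial>M)"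
    by (subst (1 2) integral_distr) (auto simp: cis_conv_exp)
  also have "\<dots> = (\<integral>\<omega>. cis (s \<bullet> (Y \<omega>, Z \<omega>)) \<partial>M)"
    by (cases s) (simp add: char_YZ inner_prod_def)
  also have "\<dots> = (\<integral>x. cis (s \<bullet> x) \<partial>distr M borel (\<lambda>\<omega>. (Y \<omega>, Z \<omega>)))"
    using m by (subst integral_distr) auto
  finally show "(\<integral>x. cis (s \<bullet> x) \<partial>distr M borel (\<lambda>\<omega>. (Y \<omega>, Z \<omega>)))
     = (\<integral>x. cis (s \<bullet> x) \<partial>(distr M borel Y \<Otimes>\<^sub>M distr M borel Z))" ..
qed simp

text \<open>Positivity of \<open>q\<close> rules out the degenerate alternative, and the second
  moment identifies the standard deviation.\<close>

lemma distributed_Y: "distributed M lborel Y (\<lambda>x. ennreal (normal_density 0 (sqrt q) x))"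
  using functional[of a]
proof
  assume "AE \<omega> in M. a \<bullet> X \<omega> = 0"
  then have "expectation (\<lambda>\<omega>. (a \<bullet> X \<omega>)\<^sup>2) = 0"
    by (intro integral_eq_zero_AE) auto
  then show ?thesis using q_pos variance_a by simp
next
  assume "\<exists>\<sigma>>0. distributed M lborel (\<lambda>\<omega>. a \<bullet> X \<omega>) (\<lambda>x. ennreal (normal_density 0 \<sigma> x))"
  then obtain \<sigma> where s: "\<sigma> > 0" and d: "distributed M lborel (\<lambda>\<omega>. a \<bullet> X \<omega>) (\<lambda>x. ennreal (normal_density 0 \<sigma> x))"
    by auto
  have "q = \<sigma>\<^sup>2"
    using normal_distributed_variance[OF s d] normal_distributed_expectation[OF s d] variance_a by simp
  then show ?thesis using s d by (simp add: Y_def[abs_def])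
qed

text \<open>The integral over \<open>Y\<close> is placed innermost, so that for fixed
  \<open>z\<close> a substitution in a one-dimensional Lebesgue integral is available even if
  \<open>X\<close> has no density.\<close>

lemma nn_integral_YZ:
  assumes F[measurable]: "(\<lambda>(y, z). F y z) \<in> borel_measurable (borel \<Otimes>\<^sub>M borel)"
  shows "(\<integral>\<^sup>+\<omega>. F (Y \<omega>) (Z \<omega>) \<partial>M)
    = (\<integral>\<^sup>+z. \<integral>\<^sup>+y. ennreal (normal_density 0 (sqrt q) y) * F y z \<partial>lborel \<partial>distr M borel Z)"
proof -
  interpret LY: prob_space "distr M borel Y" by (rule prob_space_distr) simp
  interpret LZ: prob_space "distr M borel Z" by (rule prob_space_distr) simp
  interpret P: pair_prob_space "distr M borel Y" "distr M borel Z" ..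
  have S[measurable_cong]: "sets (distr M borel Y \<Otimes>\<^sub>M distr M borel Z) = sets (borel \<Otimes>\<^sub>M borel)"
    by (simp cong: sets_pair_measure_cong)
  have LY: "distr M borel Y = density lborel (\<lambda>x. ennreal (normal_density 0 (sqrt q) x))"
    using distributed_Y by (simp add: distributed_def cong: distr_cong)
  have F': "(\<lambda>(y, z). F y z) \<in> borel_measurable borel"
    using F by (simp add: borel_prod)
  have "(\<integral>\<^sup>+\<omega>. F (Y \<omega>) (Z \<omega>) \<partial>M) = (\<integral>\<^sup>+x. (case x of (y, z) \<Rightarrow> F y z) \<partial>distr M borel (\<lambda>\<omega>. (Y \<omega>, Z \<omega>)))"
    using F' by (subst nn_integral_distr) auto
  also have "\<dots> = (\<integral>\<^sup>+z. \<integral>\<^sup>+y. F y z \<partial>distr M borel Y \<partial>distr M borel Z)"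
    unfolding law_YZ by (subst P.nn_integral_snd[symmetric]) auto
  also have "\<dots> = (\<integral>\<^sup>+z. \<integral>\<^sup>+y. ennreal (normal_density 0 (sqrt q) y) * F y z \<partial>lborel \<partial>distr M borel Z)"
  proof (intro nn_integral_cong)
    fix z
    have [measurable]: "(\<lambda>y. F y z) \<in> borel_measurable borel"
      by measurable
    show "(\<integral>\<^sup>+y. F y z \<partial>distr M borel Y) = (\<integral>\<^sup>+y. ennreal (normal_density 0 (sqrt q) y) * F y z \<partial>lborel)"
      unfolding LY by (subst nn_integral_density) auto
  qed
  finally show ?thesis .
qed

text \<open>The likelihood ratio of N(e, q) against N(0, q) at the point
  \<open>a \<bullet> x\<close>; it is the Cameron-Martin density of \<open>X + e *\<^sub>R v\<close>
  relative to the law of \<open>X\<close>.\<close>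

definition shift_density :: "real \<Rightarrow> 'b \<Rightarrow> real" where
  "shift_density e x = exp ((2 * e * (a \<bullet> x) - e\<^sup>2) / (2 * q))"

lemma measurable_shift_density[measurable]: "shift_density e \<in> borel_measurable borel"
  by (simp add: shift_density_def[abs_def])

lemma normal_density_shift:
  "normal_density 0 (sqrt q) (y - e) = exp ((2 * e * y - e\<^sup>2) / (2 * q)) * normal_density 0 (sqrt q) y"
proof -
  have "- ((y - e)\<^sup>2 / (2 * q)) = (2 * e * y - e\<^sup>2) / (2 * q) + - (y\<^sup>2 / (2 * q))"
    using q_pos by (simp add: power2_eq_square field_simps)
  then have "exp (- ((y - e)\<^sup>2 / (2 * q))) = exp ((2 * e * y - e\<^sup>2) / (2 * q)) * exp (- (y\<^sup>2 / (2 * q)))"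
    by (simp only: exp_add[symmetric])
  then show ?thesis
    using q_pos by (simp add: normal_density_def)
qed

text \<open>In the coordinates \<open>Y\<close> and \<open>Z\<close> the shift translates
  \<open>Y\<close> alone. Substituting \<open>y - e\<close> for \<open>y\<close> moves it onto the
  normal density, and \<open>normal_density_shift\<close> extracts the likelihood ratio.\<close>

lemma nn_integral_shift:
  assumes f[measurable]: "f \<in> borel_measurable borel"
  shows "(\<integral>\<^sup>+\<omega>. f (X \<omega> + e *\<^sub>R v) \<partial>M) = (\<integral>\<^sup>+\<omega>. ennreal (shift_density e (X \<omega>)) * f (X \<omega>) \<partial>M)"
proof -
  let ?\<phi> = "normal_density 0 (sqrt q)"
  have X_eq: "X \<omega> = Z \<omega> + Y \<omega> *\<^sub>R v" for \<omega> by (simp add: Z_def)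
  have "(\<integral>\<^sup>+\<omega>. f (X \<omega> + e *\<^sub>R v) \<partial>M) = (\<integral>\<^sup>+\<omega>. f (Z \<omega> + (Y \<omega> + e) *\<^sub>R v) \<partial>M)"
    by (simp add: Z_def algebra_simps)
  also have "\<dots> = (\<integral>\<^sup>+z. \<integral>\<^sup>+y. ennreal (?\<phi> y) * f (z + (y + e) *\<^sub>R v) \<partial>lborel \<partial>distr M borel Z)"
    by (rule nn_integral_YZ) measurable
  also have "\<dots> = (\<integral>\<^sup>+z. \<integral>\<^sup>+y. ennreal (?\<phi> (y - e)) * f (z + y *\<^sub>R v) \<partial>lborel \<partial>distr M borel Z)"
  proof (rule nn_integral_cong)
    fix z
    show "(\<integral>\<^sup>+y. ennreal (?\<phi> y) * f (z + (y + e) *\<^sub>R v) \<partial>lborel)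
      = (\<integral>\<^sup>+y. ennreal (?\<phi> (y - e)) * f (z + y *\<^sub>R v) \<partial>lborel)"
      using nn_integral_real_affine[of "\<lambda>y. ennreal (?\<phi> (y - e)) * f (z + y *\<^sub>R v)" 1 e]
      by (simp add: add.commute)
  qed
  also have "\<dots> = (\<integral>\<^sup>+z. \<integral>\<^sup>+y. ennreal (?\<phi> y) *
      (ennreal (exp ((2 * e * y - e\<^sup>2) / (2 * q))) * f (z + y *\<^sub>R v)) \<partial>lborel \<partial>distr M borel Z)"
    by (simp add: normal_density_shift ennreal_mult' mult_ac)
  also have "\<dots> = (\<integral>\<^sup>+\<omega>. ennreal (exp ((2 * e * Y \<omega> - e\<^sup>2) / (2 * q))) * f (Z \<omega> + Y \<omega> *\<^sub>R v) \<partial>M)"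
    by (rule nn_integral_YZ[symmetric]) measurable
  also have "\<dots> = (\<integral>\<^sup>+\<omega>. ennreal (shift_density e (X \<omega>)) * f (X \<omega>) \<partial>M)"
    unfolding X_eq[symmetric] by (simp add: shift_density_def Y_def)
  finally show ?thesis .
qed

lemma nn_integral_shift_density: "(\<integral>\<^sup>+\<omega>. ennreal (shift_density e (X \<omega>)) \<partial>M) = 1"
  using nn_integral_shift[of "\<lambda>_. 1" e] by (simp add: emeasure_space_1)

text \<open>The square of the ratio for \<open>e\<close> is \<open>exp (e\<^sup>2 / q)\<close> times
  the ratio for \<open>2 * e\<close>, which integrates to one. Hence the \<chi>-square divergence of
  the shift is \<open>exp (e\<^sup>2 / q) - 1\<close>.\<close>

lemma nn_integral_shift_density_square:
  "(\<integral>\<^sup>+\<omega>. ennreal ((shift_density e (X \<omega>))\<^sup>2) \<partial>M) = ennreal (exp (e\<^sup>2 / q))"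
proof -
  have "(shift_density e x)\<^sup>2 = exp (e\<^sup>2 / q) * shift_density (2 * e) x" for x
  proof -
    have "2 * ((2 * e * (a \<bullet> x) - e\<^sup>2) / (2 * q)) = e\<^sup>2 / q + (2 * (2 * e) * (a \<bullet> x) - (2 * e)\<^sup>2) / (2 * q)"
      using q_pos by (simp add: power2_eq_square field_simps)
    then show ?thesis
      by (simp add: shift_density_def flip: exp_double exp_add)
  qed
  then have "(\<integral>\<^sup>+\<omega>. ennreal ((shift_density e (X \<omega>))\<^sup>2) \<partial>M)
     = (\<integral>\<^sup>+\<omega>. ennreal (exp (e\<^sup>2 / q)) * ennreal (shift_density (2 * e) (X \<omega>)) \<partial>M)"
    by (simp add: ennreal_mult')
  also have "\<dots> = ennreal (exp (e\<^sup>2 / q))"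
    by (simp add: nn_integral_cmult nn_integral_shift_density)
  finally show ?thesis .
qed

end

subsection \<open>Distinguishing product measures\<close>

lemma PiM_density:
  fixes N :: "'b measure" and l :: "'b \<Rightarrow> real"
  assumes "prob_space N" "finite I"
    and l[measurable]: "l \<in> borel_measurable N" and nonneg: "\<And>x. 0 \<le> l x"
    and one: "(\<integral>\<^sup>+x. ennreal (l x) \<partial>N) = 1"
  shows "PiM I (\<lambda>_. density N (\<lambda>x. ennreal (l x)))
    = density (PiM I (\<lambda>_. N)) (\<lambda>x. ennreal (\<Prod>i\<in>I. l (x i)))"
proof -
  interpret N: prob_space N by fact
  interpret D: prob_space "density N (\<lambda>x. ennreal (l x))"
    using one by (intro prob_spaceI) (simp add: emeasure_density cong: nn_integral_cong)
  interpret PN: product_sigma_finite "\<lambda>_. N" ..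
  interpret PD: product_sigma_finite "\<lambda>_. density N (\<lambda>x. ennreal (l x))" ..
  show ?thesis
  proof (rule PD.PiM_eqI[symmetric])
    show "finite I" by fact
    show "sets (density (Pi\<^sub>M I (\<lambda>_. N)) (\<lambda>x. ennreal (\<Prod>i\<in>I. l (x i))))
      = sets (Pi\<^sub>M I (\<lambda>_. density N (\<lambda>x. ennreal (l x))))"
      by (simp cong: sets_PiM_cong)
    fix A assume "\<And>i. i \<in> I \<Longrightarrow> A i \<in> sets (density N (\<lambda>x. ennreal (l x)))"
    then have A: "\<And>i. i \<in> I \<Longrightarrow> A i \<in> sets N" by simp
    have "emeasure (density (Pi\<^sub>M I (\<lambda>_. N)) (\<lambda>x. ennreal (\<Prod>i\<in>I. l (x i)))) (Pi\<^sub>E I A)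
      = (\<integral>\<^sup>+x. ennreal (\<Prod>i\<in>I. l (x i)) * indicator (Pi\<^sub>E I A) x \<partial>Pi\<^sub>M I (\<lambda>_. N))"
      using A \<open>finite I\<close> by (intro emeasure_density sets_PiM_I_finite) auto
    also have "\<dots> = (\<integral>\<^sup>+x. (\<Prod>i\<in>I. ennreal (l (x i)) * indicator (A i) (x i)) \<partial>Pi\<^sub>M I (\<lambda>_. N))"
    proof (rule nn_integral_cong)
      fix x assume "x \<in> space (Pi\<^sub>M I (\<lambda>_. N))"
      \<comment> \<open>Membership in \<open>Pi\<^sub>E\<close> also demands extensionality, so the
        indicator factors over coordinates only on the space of the product.\<close>
      then have "x \<in> extensional I" by (simp add: space_PiM PiE_def)
      then have "indicator (Pi\<^sub>E I A) x = (\<Prod>i\<in>I. indicator (A i) (x i) :: ennreal)"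
        using \<open>finite I\<close> by (auto simp: indicator_def PiE_def Pi_iff)
      then show "ennreal (\<Prod>i\<in>I. l (x i)) * indicator (Pi\<^sub>E I A) x
        = (\<Prod>i\<in>I. ennreal (l (x i)) * indicator (A i) (x i))"
        by (simp add: prod.distrib prod_ennreal nonneg)
    qed
    also have "\<dots> = (\<Prod>i\<in>I. \<integral>\<^sup>+x. ennreal (l x) * indicator (A i) x \<partial>N)"
      using A by (intro PN.product_nn_integral_prod \<open>finite I\<close>) auto
    also have "\<dots> = (\<Prod>i\<in>I. emeasure (density N (\<lambda>x. ennreal (l x))) (A i))"
      using A by (intro prod.cong refl) (simp add: emeasure_density)
    finally show "emeasure (density (Pi\<^sub>M I (\<lambda>_. N)) (\<lambda>x. ennreal (\<Prod>i\<in>I. l (x i)))) (Pi\<^sub>E I A)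
      = (\<Prod>i\<in>I. emeasure (density N (\<lambda>x. ennreal (l x))) (A i))" .
  qed
qed

text \<open>The difference is the integral of \<open>(l x - 1) * indicator E x\<close>. Its square
  is at most the integral of \<open>(l x - 1)\<^sup>2\<close>, which is the \<chi>-square divergence
  \<open>K - 1\<close>.\<close>

lemma measure_density_diff_le:
  fixes l :: "'b \<Rightarrow> real"
  assumes "prob_space N" and l[measurable]: "l \<in> borel_measurable N" and nonneg: "\<And>x. 0 \<le> l x"
    and one: "(\<integral>\<^sup>+x. ennreal (l x) \<partial>N) = 1"
    and square: "(\<integral>\<^sup>+x. ennreal ((l x)\<^sup>2) \<partial>N) = ennreal K"
    and E[measurable]: "E \<in> sets N"
  shows "\<bar>measure (density N (\<lambda>x. ennreal (l x))) E - measure N E\<bar> \<le> sqrt (K - 1)"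
proof -
  interpret N: prob_space N by fact
  have int: "integrable N l" "integrable N (\<lambda>x. (l x)\<^sup>2)"
    using one square nonneg by (auto intro!: integrableI_nonneg)
  \<comment> \<open>\<open>ennreal\<close> sends negative reals to zero, so a negative
    \<open>K\<close> would force \<open>l\<close> to vanish almost everywhere, against total mass
    one.\<close>
  have K0: "0 \<le> K"
  proof (rule ccontr)
    assume "\<not> 0 \<le> K"
    then have "AE x in N. l x = 0"
      using square by (simp add: ennreal_neg nn_integral_0_iff_AE)
    then have "AE x in N. ennreal (l x) = 0" by eventually_elim simp
    then have "(\<integral>\<^sup>+x. ennreal (l x) \<partial>N) = 0"
      by (simp add: nn_integral_0_iff_AE)
    with one show False by simp
  qed
  have El: "(\<integral>x. l x \<partial>N) = 1" and El2: "(\<integral>x. (l x)\<^sup>2 \<partial>N) = K"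
    using one square nonneg K0 by (auto simp: integral_eq_nn_integral)
  define f where "f x = (l x - 1) * indicator E x" for x
  have f[measurable]: "f \<in> borel_measurable N" by (simp add: f_def[abs_def])
  have f2: "(f x)\<^sup>2 \<le> (l x)\<^sup>2 - 2 * l x + 1" for x
  proof -
    have "(l x)\<^sup>2 - 2 * l x + 1 = (l x - 1)\<^sup>2" by (simp add: power2_diff)
    then show ?thesis by (simp add: f_def split: split_indicator)
  qed
  have int_f: "integrable N f"
    using int(1) by (auto simp: f_def[abs_def] intro!: integrable_mult_indicator integrable_real_mult_indicator)
  have int_f2: "integrable N (\<lambda>x. (f x)\<^sup>2)"
  proof (rule Bochner_Integration.integrable_bound)
    show "integrable N (\<lambda>x. (l x)\<^sup>2 - 2 * l x + 1)" using int by simp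
    have "norm ((f x)\<^sup>2) \<le> norm ((l x)\<^sup>2 - 2 * l x + 1)" for x
      using f2[of x] by simp
    then show "AE x in N. norm ((f x)\<^sup>2) \<le> norm ((l x)\<^sup>2 - 2 * l x + 1)" by simp
  qed simp
  have "measure (density N (\<lambda>x. ennreal (l x))) E = (\<integral>x. l x * indicator E x \<partial>N)"
    using nonneg by (simp add: measure_density_const measure_def emeasure_density integral_eq_nn_integral
      ennreal_mult' ennreal_indicator)
  moreover have "measure N E = (\<integral>x. indicator E x \<partial>N)" by simp
  moreover have "integrable N (\<lambda>x. l x * indicator E x)" "integrable N (\<lambda>x. indicator E x :: real)"
    using int(1) by (intro integrable_real_mult_indicator) (auto simp: less_top[symmetric])
  ultimately have "measure (density N (\<lambda>x. ennreal (l x))) E - measure N E = (\<integral>x. f x \<partial>N)"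
    by (simp add: f_def[abs_def] left_diff_distrib Bochner_Integration.integral_diff del: integral_indicator)
  \<comment> \<open>Nonnegativity of the variance of \<open>f\<close>.\<close>
  moreover have "(\<integral>x. f x \<partial>N)\<^sup>2 \<le> (\<integral>x. (f x)\<^sup>2 \<partial>N)"
    using N.variance_eq[OF int_f int_f2] N.variance_positive[of f] by simp
  moreover have "(\<integral>x. (f x)\<^sup>2 \<partial>N) \<le> (\<integral>x. (l x)\<^sup>2 - 2 * l x + 1 \<partial>N)"
    using int int_f2 by (intro integral_mono f2) auto
  moreover have "\<dots> = K - 1"
    using int by (simp add: El El2 N.prob_space)
  ultimately have "(measure (density N (\<lambda>x. ennreal (l x))) E - measure N E)\<^sup>2 \<le> K - 1"
    by simp
  then show ?thesis by (rule real_le_rsqrt[of "\<bar>_\<bar>", unfolded power2_abs])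
qed

section \<open>Total variation between samples with shifted means\<close>

context gaussian_regression
begin

definition law :: "real \<Rightarrow> 'b measure" where
  "law \<theta> = distr M borel (\<lambda>\<omega>. X \<omega> + \<theta> *\<^sub>R v)"

lemma sets_law[simp, measurable_cong]: "sets (law \<theta>) = sets borel"
  by (simp add: law_def)

lemma prob_space_law: "prob_space (law \<theta>)"
  unfolding law_def by (rule prob_space_distr) simp

lemma law_add: "law (\<theta> + e) = density (law \<theta>) (\<lambda>x. ennreal (shift_density e (x - \<theta> *\<^sub>R v)))"
proof (rule measure_eqI)
  fix A assume "A \<in> sets (law (\<theta> + e))"
  then have A[measurable]: "A \<in> sets borel" by simp
  have "emeasure (law (\<theta> + e)) A = (\<integral>\<^sup>+x. indicator A x \<partial>law (\<theta> + e))" by simp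
  also have "\<dots> = (\<integral>\<^sup>+\<omega>. indicator A (X \<omega> + e *\<^sub>R v + \<theta> *\<^sub>R v) \<partial>M)"
    unfolding law_def by (subst nn_integral_distr) (auto simp: algebra_simps)
  also have "\<dots> = (\<integral>\<^sup>+\<omega>. ennreal (shift_density e (X \<omega>)) * indicator A (X \<omega> + \<theta> *\<^sub>R v) \<partial>M)"
    by (rule nn_integral_shift) simp
  also have "\<dots> = (\<integral>\<^sup>+x. ennreal (shift_density e (x - \<theta> *\<^sub>R v)) * indicator A x \<partial>law \<theta>)"
    unfolding law_def by (subst nn_integral_distr) auto
  also have "\<dots> = emeasure (density (law \<theta>) (\<lambda>x. ennreal (shift_density e (x - \<theta> *\<^sub>R v)))) A"
    by (subst emeasure_density) auto
  finally show "emeasure (law (\<theta> + e)) A = \<dots>" .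
qed simp

text \<open>Second moments of likelihood ratios multiply over independent coordinates, so the
  exponent of a single shift is multiplied by \<open>card I\<close>. Parameters at distance small
  against \<open>sqrt (q / card I)\<close> therefore give nearly equal probabilities.\<close>

lemma measure_PiM_law_diff_le:
  fixes \<theta> \<theta>' :: real
  assumes I: "finite I" and E: "E \<in> sets (PiM I (\<lambda>_. borel))"
  shows "\<bar>measure (PiM I (\<lambda>_. law \<theta>')) E - measure (PiM I (\<lambda>_. law \<theta>)) E\<bar>
    \<le> sqrt (exp (card I * (\<theta>' - \<theta>)\<^sup>2 / q) - 1)"
proof -
  define l where "l x = shift_density (\<theta>' - \<theta>) (x - \<theta> *\<^sub>R v)" for x
  interpret N: prob_space "law \<theta>" by (rule prob_space_law)
  interpret P: product_prob_space "\<lambda>_. law \<theta>" ..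
  have l[measurable]: "l \<in> borel_measurable (law \<theta>)" unfolding l_def by measurable
  have nonneg: "0 \<le> l x" for x by (simp add: l_def shift_density_def)
  have one: "(\<integral>\<^sup>+x. ennreal (l x) \<partial>law \<theta>) = 1"
    unfolding law_def by (subst nn_integral_distr) (simp_all add: l_def nn_integral_shift_density)
  have square: "(\<integral>\<^sup>+x. ennreal ((l x)\<^sup>2) \<partial>law \<theta>) = ennreal (exp ((\<theta>' - \<theta>)\<^sup>2 / q))"
    unfolding law_def by (subst nn_integral_distr) (simp_all add: l_def nn_integral_shift_density_square)
  let ?L = "\<lambda>x. \<Prod>i\<in>I. l (x i)"
  have eq: "PiM I (\<lambda>_. law \<theta>') = density (PiM I (\<lambda>_. law \<theta>)) (\<lambda>x. ennreal (?L x))"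
    using law_add[of \<theta> "\<theta>' - \<theta>"] PiM_density[OF N.prob_space_axioms I l nonneg one]
    by (simp add: l_def)
  have "\<bar>measure (density (PiM I (\<lambda>_. law \<theta>)) (\<lambda>x. ennreal (?L x))) E - measure (PiM I (\<lambda>_. law \<theta>)) E\<bar>
     \<le> sqrt (exp (card I * (\<theta>' - \<theta>)\<^sup>2 / q) - 1)"
  proof (rule measure_density_diff_le)
    show "E \<in> sets (Pi\<^sub>M I (\<lambda>_. law \<theta>))" using E by (simp cong: sets_PiM_cong)
    show "(\<integral>\<^sup>+x. ennreal (?L x) \<partial>Pi\<^sub>M I (\<lambda>_. law \<theta>)) = 1"
      using P.product_nn_integral_prod[OF I, of "\<lambda>_ x. ennreal (l x)"]
      by (simp add: prod_ennreal nonneg one)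
    have "(\<integral>\<^sup>+x. ennreal ((?L x)\<^sup>2) \<partial>Pi\<^sub>M I (\<lambda>_. law \<theta>))
       = (\<Prod>i\<in>I. \<integral>\<^sup>+x. ennreal ((l x)\<^sup>2) \<partial>law \<theta>)"
      using P.product_nn_integral_prod[OF I, of "\<lambda>_ x. ennreal ((l x)\<^sup>2)"]
      by (simp add: prod_ennreal nonneg prod_power_distrib)
    also have "\<dots> = ennreal (exp (card I * (\<theta>' - \<theta>)\<^sup>2 / q))"
      by (simp add: square ennreal_power exp_of_nat_mult[symmetric])
    finally show "(\<integral>\<^sup>+x. ennreal ((?L x)\<^sup>2) \<partial>Pi\<^sub>M I (\<lambda>_. law \<theta>))
       = ennreal (exp (card I * (\<theta>' - \<theta>)\<^sup>2 / q))" .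
  qed (auto intro!: prod_nonneg nonneg prob_space_PiM prob_space_law)
  then show ?thesis unfolding eq .
qed

end

subsection \<open>Nested choice of the parameter\<close>

text \<open>Intended reading: \<open>F t \<theta> \<alpha> r\<close> is the probability, under
  \<theta>, that the price computed from \<open>t\<close> observations lies at distance at least
  \<open>r\<close> from \<open>\<alpha> *\<^sub>R v\<close>, with \<open>V = norm v\<close>. Keeping
  the law \<theta> apart from the target \<alpha> allows each to be changed at its own cost:
  \<open>close\<close> for the law, \<open>recentre\<close> for the target.\<close>

lemma nested_parameter_exists:
  fixes F :: "nat \<Rightarrow> real \<Rightarrow> real \<Rightarrow> real \<Rightarrow> real" and q V :: real
  assumes q: "0 < q" and V: "0 \<le> V"
    and close: "\<And>t \<theta> \<theta>' \<alpha> r. \<bar>F t \<theta>' \<alpha> r - F t \<theta> \<alpha> r\<bar> \<le> sqrt (exp (t * (\<theta>' - \<theta>)\<^sup>2 / q) - 1)"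
    and separate: "\<And>t \<theta> \<alpha> \<beta> r. 2 * r \<le> \<bar>\<alpha> - \<beta>\<bar> * V \<Longrightarrow> 1 \<le> F t \<theta> \<alpha> r + F t \<theta> \<beta> r"
    and recentre: "\<And>t \<theta> \<alpha> \<beta> r r'. r' + \<bar>\<alpha> - \<beta>\<bar> * V \<le> r \<Longrightarrow> F t \<theta> \<alpha> r \<le> F t \<theta> \<beta> r'"
  shows "\<exists>\<theta>. \<forall>g. 64 ^ g / 8 \<le> (\<Sum>t\<in>{64 ^ g<..2 * 64 ^ g}. F t \<theta> \<theta> (sqrt q * V / (16 * 8 ^ g)))"
proof -
  \<comment> \<open>Scaled so that \<open>64 ^ g * (\<delta> g)\<^sup>2 = q / 16\<close>; for at
    most \<open>2 * 64 ^ g\<close> observations the exponent in \<open>close\<close> is then at most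
    \<open>1 / 8\<close>.\<close>
  define \<delta> where "\<delta> g = sqrt q / (4 * 8 ^ g)" for g :: nat
  have \<delta>_pos: "0 < \<delta> g" and \<delta>_Suc: "\<delta> (Suc g) = \<delta> g / 8" for g
    using q by (simp_all add: \<delta>_def)
  have \<delta>_sq: "64 ^ g * (\<delta> g)\<^sup>2 = q / 16" for g
  proof -
    have "(8 ^ g)\<^sup>2 = (64 ^ g :: real)"
      by (simp add: power2_eq_square flip: power_mult_distrib)
    then show ?thesis
      using q by (simp add: \<delta>_def power_divide power_mult_distrib)
  qed
  \<comment> \<open>With exponent \<open>x \<le> s\<^sup>2 / 8\<close>, the estimate
    \<open>exp x \<le> 1 + 2 * x\<close> gives the bound. It is used with \<open>s = 1\<close> to
    compare the two candidates and with \<open>s = 1 / 7\<close> for all later corrections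
    together.\<close>
  have tv: "sqrt (exp (t * d\<^sup>2 / q) - 1) \<le> s / 2"
    if t: "t \<in> {64 ^ g<..2 * 64 ^ g}" and d: "\<bar>d\<bar> \<le> s * \<delta> g" and s: "0 \<le> s" "s \<le> 1" for t g :: nat and d s :: real
  proof -
    define x where "x = t * d\<^sup>2 / q"
    have "d\<^sup>2 \<le> (s * \<delta> g)\<^sup>2"
      using power_mono[OF d, of 2] by simp
    moreover have "real t \<le> 2 * 64 ^ g" using t by (simp flip: of_nat_le_iff[where 'a=real])
    ultimately have "t * d\<^sup>2 \<le> (2 * 64 ^ g) * (s * \<delta> g)\<^sup>2"
      by (intro mult_mono) auto
    also have "\<dots> = s\<^sup>2 * q / 8"
      using \<delta>_sq[of g] by (simp add: power_mult_distrib)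
    finally have x8: "x \<le> s\<^sup>2 / 8" using q by (simp add: x_def field_simps)
    have x0: "0 \<le> x" using q by (simp add: x_def)
    have "s\<^sup>2 \<le> 1" using s by (simp add: power_le_one)
    then have x1: "x \<le> 1" using x8 by simp
    have "exp x \<le> 1 + x + x\<^sup>2" by (rule exp_bound[OF x0 x1])
    also have "x\<^sup>2 \<le> x" using x0 x1 by (simp add: power2_eq_square mult_left_le)
    finally have "exp x - 1 \<le> (s / 2)\<^sup>2" using x8 by (simp add: power_divide)
    then show ?thesis
      unfolding x_def using s by (intro real_le_lsqrt) auto
  qed
  let ?B = "\<lambda>g. {64 ^ g<..2 * 64 ^ g} :: nat set"
  have cardB: "card (?B g) = 64 ^ g" for g by simp
  define good where "good g \<theta> \<longleftrightarrow> 64 ^ g / 4 \<le> (\<Sum>t\<in>?B g. F t \<theta> \<theta> (\<delta> g * V / 2))" for g \<theta>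
  \<comment> \<open>Under one law the two error probabilities sum to at least 1; moving the second
    to its own law costs at most \<open>1 / 2\<close>. What remains, summed over the block, is at
    least \<open>64 ^ g / 2\<close>, and one candidate receives half of it.\<close>
  have choice: "good g \<theta> \<or> good g (\<theta> + \<delta> g)" for g \<theta>
  proof -
    have "1 / 2 \<le> F t \<theta> \<theta> (\<delta> g * V / 2) + F t (\<theta> + \<delta> g) (\<theta> + \<delta> g) (\<delta> g * V / 2)" if "t \<in> ?B g" for t
    proof -
      have "1 \<le> F t \<theta> \<theta> (\<delta> g * V / 2) + F t \<theta> (\<theta> + \<delta> g) (\<delta> g * V / 2)"
        using \<delta>_pos[of g] by (intro separate) simp
      moreover have "\<bar>F t (\<theta> + \<delta> g) (\<theta> + \<delta> g) (\<delta> g * V / 2) - F t \<theta> (\<theta> + \<delta> g) (\<delta> g * V / 2)\<bar> \<le> 1 / 2"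
        using tv[OF that, of "\<delta> g" 1] \<delta>_pos[of g] by (intro order.trans[OF close]) simp
      ultimately show ?thesis by linarith
    qed
    then have "(\<Sum>t\<in>?B g. 1 / 2)
      \<le> (\<Sum>t\<in>?B g. F t \<theta> \<theta> (\<delta> g * V / 2) + F t (\<theta> + \<delta> g) (\<theta> + \<delta> g) (\<delta> g * V / 2))"
      by (rule sum_mono)
    then show ?thesis
      unfolding good_def sum.distrib by (auto simp: cardB)
  qed
  define \<theta> where "\<theta> = rec_nat 0 (\<lambda>g x. if good g x then x else x + \<delta> g)"
  have \<theta>_Suc: "\<theta> (Suc g) = (if good g (\<theta> g) then \<theta> g else \<theta> g + \<delta> g)" for g
    by (simp add: \<theta>_def)
  have good: "good g (\<theta> (Suc g))" for g
    using choice[of g "\<theta> g"] by (auto simp: \<theta>_Suc)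
  have mono: "incseq \<theta>"
    using \<delta>_pos by (intro incseq_SucI) (auto simp: \<theta>_Suc less_imp_le)
  \<comment> \<open>The factor \<open>8 / 7\<close> is the sum of the powers of
    \<open>1 / 8\<close>: it bounds all corrections from \<open>g\<close> on, and one correction by
    \<open>\<delta> g\<close> uses up exactly the decrease of the tail.\<close>
  have "decseq (\<lambda>g. \<theta> g + 8 / 7 * \<delta> g)"
    using \<delta>_pos by (intro decseq_SucI) (auto simp: \<theta>_Suc \<delta>_Suc less_imp_le)
  then have upper: "\<theta> h \<le> \<theta> g + 8 / 7 * \<delta> g" for g h
  proof (cases "g \<le> h")
    case True
    show ?thesis using decseqD[OF \<open>decseq _\<close> True] \<delta>_pos[of h] by simp
  next
    case False
    then show ?thesis using incseqD[OF mono, of h g] \<delta>_pos[of g] by simp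
  qed
  define \<theta>\<^sub>l where "\<theta>\<^sub>l = (SUP h. \<theta> h)"
  have lo: "\<theta> g \<le> \<theta>\<^sub>l" for g
    unfolding \<theta>\<^sub>l_def using upper[of _ 0] by (intro cSUP_upper bdd_aboveI2) auto
  have hi: "\<theta>\<^sub>l \<le> \<theta> g + 8 / 7 * \<delta> g" for g
    unfolding \<theta>\<^sub>l_def using upper by (intro cSUP_least) auto
  \<comment> \<open>After the choice at scale \<open>g\<close> only the tail from
    \<open>Suc g\<close> is left, and
    \<open>8 / 7 * \<delta> (Suc g) = \<delta> g / 7\<close>.\<close>
  have near: "\<bar>\<theta>\<^sub>l - \<theta> (Suc g)\<bar> \<le> 1 / 7 * \<delta> g" for g
    using lo[of "Suc g"] hi[of "Suc g"] by (simp add: \<delta>_Suc)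
  show ?thesis
  proof (intro exI allI)
    fix g
    \<comment> \<open>Halving the radius pays for moving the target from
      \<open>\<theta> (Suc g)\<close> to the limit, and the change of law costs at most
      \<open>1 / 14\<close>, rounded up to \<open>1 / 8\<close>. From the average
      \<open>1 / 4\<close> of \<open>good\<close> an average of \<open>1 / 8\<close>
      survives.\<close>
    have "F t (\<theta> (Suc g)) (\<theta> (Suc g)) (\<delta> g * V / 2) - 1 / 8 \<le> F t \<theta>\<^sub>l \<theta>\<^sub>l (\<delta> g * V / 4)" if "t \<in> ?B g" for t
    proof -
      have "F t \<theta>\<^sub>l (\<theta> (Suc g)) (\<delta> g * V / 2) \<le> F t \<theta>\<^sub>l \<theta>\<^sub>l (\<delta> g * V / 4)"
      proof (rule recentre)
        have "\<bar>\<theta> (Suc g) - \<theta>\<^sub>l\<bar> * V \<le> (1 / 4 * \<delta> g) * V"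
          using near[of g] \<delta>_pos[of g] V by (intro mult_right_mono) (auto simp: abs_minus_commute)
        then show "\<delta> g * V / 4 + \<bar>\<theta> (Suc g) - \<theta>\<^sub>l\<bar> * V \<le> \<delta> g * V / 2" by (simp add: mult_ac)
      qed
      moreover have "\<bar>F t \<theta>\<^sub>l (\<theta> (Suc g)) (\<delta> g * V / 2) - F t (\<theta> (Suc g)) (\<theta> (Suc g)) (\<delta> g * V / 2)\<bar> \<le> 1 / 8"
        using tv[OF that near] by (intro order.trans[OF close]) simp
      ultimately show ?thesis by linarith
    qed
    then have "(\<Sum>t\<in>?B g. F t (\<theta> (Suc g)) (\<theta> (Suc g)) (\<delta> g * V / 2) - 1 / 8)
       \<le> (\<Sum>t\<in>?B g. F t \<theta>\<^sub>l \<theta>\<^sub>l (\<delta> g * V / 4))"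
      by (rule sum_mono)
    then show "64 ^ g / 8 \<le> (\<Sum>t\<in>?B g. F t \<theta>\<^sub>l \<theta>\<^sub>l (sqrt q * V / (16 * 8 ^ g)))"
      using good[of g] by (simp add: good_def sum_subtractf cardB \<delta>_def mult_ac)
  qed
qed

text \<open>The blocks are disjoint, and if \<open>G\<close> is the last one ending by day
  \<open>T\<close>, there are \<open>Suc G\<close> of them while \<open>T < 2 * 64 ^ Suc G\<close>.
  Using \<open>ln 128 = ln 2 + ln 64\<close> per block absorbs the factor 2.\<close>

lemma sum_ge_of_geometric_blocks:
  fixes R :: "nat \<Rightarrow> ennreal"
  assumes blocks: "\<And>g. ennreal c \<le> (\<Sum>t\<in>{64 ^ g<..2 * 64 ^ g}. R t)" and c: "0 \<le> c" and T: "2 \<le> T"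
  shows "ennreal (c / ln 128 * ln (real T)) \<le> (\<Sum>t = 1..T. R t)"
proof -
  have partial: "ennreal (Suc G * c) \<le> (\<Sum>t = 1..2 * 64 ^ G. R t)" for G
  proof (induction G)
    case 0
    have "(\<Sum>t\<in>{64 ^ 0<..2 * 64 ^ 0}. R t) \<le> (\<Sum>t = 1..2 * 64 ^ 0. R t)"
      by (rule sum_mono2) auto
    then show ?case using blocks[of 0] by (simp only: of_nat_Suc of_nat_0) simp
  next
    case (Suc G)
    have "ennreal (Suc (Suc G) * c) = ennreal (Suc G * c) + ennreal c"
      using c by (simp add: algebra_simps flip: ennreal_plus)
    also have "\<dots> \<le> (\<Sum>t = 1..2 * 64 ^ G. R t) + (\<Sum>t\<in>{64 ^ Suc G<..2 * 64 ^ Suc G}. R t)"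
      by (intro add_mono Suc blocks)
    also have "\<dots> = (\<Sum>t\<in>{1..2 * 64 ^ G} \<union> {64 ^ Suc G<..2 * 64 ^ Suc G}. R t)"
      by (rule sum.union_disjoint[symmetric]) auto
    also have "\<dots> \<le> (\<Sum>t = 1..2 * 64 ^ Suc G. R t)"
      by (rule sum_mono2) auto
    finally show ?case .
  qed
  have "\<exists>G. 2 * 64 ^ G \<le> T \<and> T < 2 * 64 ^ Suc G"
  proof -
    have "\<exists>n. T < 2 * 64 ^ n"
      using less_exp[of T] power_mono[of 2 "64::nat" T]
      by (intro exI[of _ T]) linarith
    then obtain n where n: "T < 2 * 64 ^ n" "\<And>m. m < n \<Longrightarrow> \<not> T < 2 * 64 ^ m"
      unfolding exists_least_iff[of "\<lambda>n. T < 2 * 64 ^ n"] by blast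
    show ?thesis using n T by (cases n) (auto simp: not_less)
  qed
  then obtain G where G: "2 * 64 ^ G \<le> T" "T < 2 * 64 ^ Suc G" by blast
  have "real T \<le> 2 * 64 ^ Suc G"
    using G(2) by (metis of_nat_le_iff less_imp_le of_nat_mult of_nat_numeral of_nat_power)
  then have "ln (real T) \<le> ln (2 * 64 ^ Suc G)" using T by simp
  also have "\<dots> = ln 2 + Suc G * ln 64" by (simp only: ln_mult ln_realpow)  simp
  also have "\<dots> \<le> Suc G * (ln 2 + ln 64)" by (simp add: distrib_left)
  also have "ln 2 + ln 64 = ln (128::real)" using ln_mult[of 2 "64::real"] by simp
  finally have "c / ln 128 * ln (real T) \<le> c / ln 128 * (Suc G * ln 128)"
    using c by (intro mult_left_mono) auto
  then have "ennreal (c / ln 128 * ln (real T)) \<le> ennreal (Suc G * c)"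
    by (intro ennreal_leI) (simp add: mult.commute)
  also have "\<dots> \<le> (\<Sum>t = 1..2 * 64 ^ G. R t)" by (rule partial)
  also have "\<dots> \<le> (\<Sum>t = 1..T. R t)"
    using G(1) by (intro sum_mono2) auto
  finally show ?thesis .
qed

subsection \<open>Regret as estimation error\<close>

text \<open>Every functional is integrable, so by linearity its mean is zero like those of the
  coordinates. This forces \<open>m = 0\<close> in both alternatives of
  \<open>gaussian_vector\<close>.\<close>

lemma centered_gaussian_of_gaussian_vector:
  fixes X :: "'a \<Rightarrow> real^'n"
  assumes "prob_space M" and gaussian: "gaussian_vector M X" and mean: "mean_vector M X = 0"
  shows "centered_gaussian M X"
proof -
  interpret prob_space M by fact
  have X[measurable]: "X \<in> borel_measurable M" using gaussian by (simp add: gaussian_vector_def)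
  have int: "integrable M (\<lambda>\<omega>. u \<bullet> X \<omega>)" for u
  proof -
    consider m where "AE \<omega> in M. u \<bullet> X \<omega> = m"
      | m \<sigma> where "0 < \<sigma>" "distributed M lborel (\<lambda>\<omega>. u \<bullet> X \<omega>) (\<lambda>x. ennreal (normal_density m \<sigma> x))"
      using gaussian unfolding gaussian_vector_def by metis
    then show ?thesis
    proof cases
      case 1
      then show ?thesis by (subst integrable_cong_AE[where g="\<lambda>_. m"]) auto
    next
      case 2
      then show ?thesis
        using distributed_integrable[OF 2(2), of "\<lambda>x. x"] integrable_normal_moment_nz_1[OF 2(1)] by simp
    qed
  qed
  have comp: "integrable M (\<lambda>\<omega>. X \<omega> $ i)" for i
    using int[of "axis i 1"] by (simp add: inner_axis')
  have comp0: "(\<integral>\<omega>. X \<omega> $ i \<partial>M) = 0" for i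
    using mean by (simp add: mean_vector_def vec_eq_iff)
  have mean0: "expectation (\<lambda>\<omega>. u \<bullet> X \<omega>) = 0" for u
    by (simp add: inner_vec_def comp comp0)
  show ?thesis
  proof
    show "X \<in> borel_measurable M" by fact
    fix u
    consider m where "AE \<omega> in M. u \<bullet> X \<omega> = m"
      | m \<sigma> where "0 < \<sigma>" "distributed M lborel (\<lambda>\<omega>. u \<bullet> X \<omega>) (\<lambda>x. ennreal (normal_density m \<sigma> x))"
      using gaussian unfolding gaussian_vector_def by metis
    then show "(AE \<omega> in M. u \<bullet> X \<omega> = 0) \<or>
      (\<exists>\<sigma>>0. distributed M lborel (\<lambda>\<omega>. u \<bullet> X \<omega>) (\<lambda>x. ennreal (normal_density 0 \<sigma> x)))"
    proof cases
      case 1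
      then have "expectation (\<lambda>\<omega>. u \<bullet> X \<omega>) = expectation (\<lambda>_. m)"
        by (intro integral_cong_AE) auto
      then show ?thesis using 1 mean0[of u] by (simp add: prob_space)
    next
      case 2
      then show ?thesis using normal_distributed_expectation[OF 2] mean0[of u] by auto
    qed
  qed
qed

lemma gaussian_regression_exists:
  fixes X :: "'a \<Rightarrow> real^'n"
  assumes "prob_space M" and gaussian: "gaussian_vector M X" and mean: "mean_vector M X = 0"
    and cov: "covariance_matrix M X \<noteq> 0"
  shows "\<exists>a v q. gaussian_regression M X a v q"
proof -
  interpret centered_gaussian M X
    by (rule centered_gaussian_of_gaussian_vector) fact+
  define S where "S = covariance_matrix M X"
  have S: "S $ i $ j = expectation (\<lambda>\<omega>. X \<omega> $ i * X \<omega> $ j)" for i j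
    by (simp add: S_def covariance_matrix_def mean)
  have prod: "integrable M (\<lambda>\<omega>. X \<omega> $ i * X \<omega> $ j)" for i j
    using integrable_product[of "axis i 1" "axis j 1"] by (simp add: inner_axis')
  \<comment> \<open>If all variances vanished, every coordinate would be zero almost everywhere, and
    with it the whole covariance matrix.\<close>
  have "\<exists>k. 0 < S $ k $ k"
  proof (rule ccontr)
    assume "\<nexists>k. 0 < S $ k $ k"
    moreover have "0 \<le> S $ k $ k" for k by (simp add: S)
    ultimately have z: "S $ k $ k = 0" for k by (metis order_less_le)
    have "S $ i $ j = 0" for i j
    proof -
      have "AE \<omega> in M. X \<omega> $ i * X \<omega> $ i = 0"
        using z[of i] prod[of i i] unfolding S by (subst (asm) integral_nonneg_eq_0_iff_AE) auto
      then show ?thesis unfolding S by (intro integral_eq_zero_AE) auto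
    qed
    then show False using cov by (simp add: S_def vec_eq_iff)
  qed
  then obtain k where k: "0 < S $ k $ k" by blast
  \<comment> \<open>Regression on coordinate \<open>k\<close>: the covariances of \<open>X\<close>
    with that coordinate, divided by its variance, form the coefficient vector.\<close>
  have "gaussian_regression M X (axis k 1) ((1 / S $ k $ k) *\<^sub>R S $ k) (S $ k $ k)"
  proof
    show "0 < S $ k $ k" by fact
    show "expectation (\<lambda>\<omega>. (axis k 1 \<bullet> X \<omega>)\<^sup>2) = S $ k $ k"
      by (simp add: inner_axis' S power2_eq_square)
    fix s
    have "expectation (\<lambda>\<omega>. (axis k 1 \<bullet> X \<omega>) * (s \<bullet> X \<omega>))
      = expectation (\<lambda>\<omega>. \<Sum>j\<in>UNIV. s $ j * (X \<omega> $ k * X \<omega> $ j))"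
      by (simp add: inner_axis' inner_vec_def[of s] sum_distrib_left mult_ac)
    also have "\<dots> = (\<Sum>j\<in>UNIV. s $ j * S $ k $ j)"
      using prod by (simp add: S)
    also have "\<dots> = S $ k $ k * (s \<bullet> ((1 / S $ k $ k) *\<^sub>R S $ k))"
      using k by (simp add: inner_vec_def sum_distrib_left)
    finally show "expectation (\<lambda>\<omega>. (axis k 1 \<bullet> X \<omega>) * (s \<bullet> X \<omega>))
      = S $ k $ k * (s \<bullet> ((1 / S $ k $ k) *\<^sub>R S $ k))" .
  qed
  then show ?thesis by blast
qed

text \<open>Taking \<open>s = a\<close> in \<open>regression\<close> yields
  \<open>a \<bullet> v = 1\<close>.\<close>

lemma (in gaussian_regression) regression_nonzero: "v \<noteq> 0"
  using regression[of a] variance_a q_pos by (auto simp: power2_eq_square)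

section \<open>Translation, causality and measurability of prices\<close>

text \<open>The intercept and the noise enter the demand only through their sum, and the policy sees
  neither of them directly. A change of \<open>b\<close> is thus a shift of the noise.\<close>

lemma real_time_demand_translate:
  "real_time_demand \<mu> A b d e t = real_time_demand \<mu> A 0 d (\<lambda>i. e i + b) t"
proof (induction t rule: less_induct)
  case (less t)
  then have "(\<lambda>i\<in>{..<t}. real_time_demand \<mu> A b d e i)
    = (\<lambda>i\<in>{..<t}. real_time_demand \<mu> A 0 d (\<lambda>i. e i + b) i)"
    by (auto simp: restrict_def)
  then show ?case
    unfolding real_time_demand_eq[of _ _ _ _ _ t] price_def by simp
qed

lemma price_translate: "price \<mu> A b d e t = price \<mu> A 0 d (\<lambda>i. e i + b) t"
proof -
  have "real_time_demand \<mu> A b d e = real_time_demand \<mu> A 0 d (\<lambda>i. e i + b)"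
    by (rule ext) (rule real_time_demand_translate)
  then show ?thesis by (simp add: price_def)
qed

lemma real_time_demand_cong:
  "(\<And>i. i \<le> t \<Longrightarrow> e i = e' i) \<Longrightarrow> real_time_demand \<mu> A b d e t = real_time_demand \<mu> A b d e' t"
proof (induction t rule: less_induct)
  case (less t)
  then have "(\<lambda>i\<in>{..<t}. real_time_demand \<mu> A b d e i) = (\<lambda>i\<in>{..<t}. real_time_demand \<mu> A b d e' i)"
    by (auto simp: restrict_def)
  then show ?case
    using less.prems unfolding real_time_demand_eq[of _ _ _ _ _ t] price_def by simp
qed

text \<open>Causality: the price depends only on earlier noise, so it is a function on a finite
  product space.\<close>

lemma price_restrict: "price \<mu> A b d e t = price \<mu> A b d (restrict e {..<t}) t"
proof -
  have "(\<lambda>i\<in>{..<t}. real_time_demand \<mu> A b d e i)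
    = (\<lambda>i\<in>{..<t}. real_time_demand \<mu> A b d (restrict e {..<t}) i)"
    by (intro restrict_ext real_time_demand_cong) auto
  then show ?thesis by (simp add: price_def)
qed

text \<open>Prices and demands feed each other, hence the strong induction. The separate
  \<open>n\<close> keeps one product space fixed while earlier days are visited.\<close>

lemma measurable_price:
  assumes \<mu>: "pricing_policy \<mu>" and "t \<le> n"
  shows "(\<lambda>x. price \<mu> A b d x t) \<in> borel_measurable (\<Pi>\<^sub>M i\<in>{..<n}. borel)"
  using \<open>t \<le> n\<close>
proof (induction t rule: less_induct)
  case (less t)
  have mult[measurable]: "(\<lambda>z. A *v z) \<in> borel_measurable borel"
    by (intro borel_measurable_continuous_onI linear_continuous_on
        matrix_vector_mul_bounded_linear)
  have demand: "(\<lambda>x. real_time_demand \<mu> A b d x i) \<in> borel_measurable (\<Pi>\<^sub>M i\<in>{..<n}. borel)" if "i < t" for i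
  proof -
    have [measurable]: "(\<lambda>x. price \<mu> A b d x i) \<in> borel_measurable (\<Pi>\<^sub>M i\<in>{..<n}. borel)"
      using less that by auto
    have [measurable]: "(\<lambda>x. x i) \<in> borel_measurable (\<Pi>\<^sub>M i\<in>{..<n}. borel :: (real^24) measure)"
      using that less.prems by (intro measurable_component_singleton) auto
    show ?thesis unfolding real_time_demand_eq by measurable
  qed
  have "(\<lambda>x. (\<lambda>i\<in>{..<t}. real_time_demand \<mu> A b d x i, \<lambda>i\<in>{..t}. d i))
    \<in> (\<Pi>\<^sub>M i\<in>{..<n}. borel) \<rightarrow>\<^sub>M (\<Pi>\<^sub>M i\<in>{..<t}. borel) \<Otimes>\<^sub>M (\<Pi>\<^sub>M i\<in>{..t}. borel)"
    using demand by (intro measurable_Pair measurable_restrict) auto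
  from measurable_compose[OF this \<mu>[unfolded pricing_policy_def, rule_format, of t]]
  show ?case by (simp add: price_def[abs_def])
qed

lemma positive_definite_mat_1: "positive_definite (mat 1)"
  by (simp add: positive_definite_def transpose_mat)

theorem theorem2:
  fixes M :: "'a measure" and w :: "nat \<Rightarrow> 'a \<Rightarrow> real^24" and \<Sigma>\<^sub>w :: "real^24^24"
    and \<mu> :: policy
  assumes "prob_space M"
    and "iid_gaussian_noise M w \<Sigma>\<^sub>w"
    and "\<Sigma>\<^sub>w \<noteq> 0"
    and "pricing_policy \<mu>"
  shows "\<exists>(A :: real^24^24) (b :: real^24) (d :: nat \<Rightarrow> real^24).
           positive_definite A \<and>
           (\<exists>c > 0. \<exists>T\<^sub>0 :: nat. \<forall>T \<ge> T\<^sub>0.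
              ennreal (c * ln (real T)) \<le> (\<Sum>t = 1..T. regret M w \<mu> A b d t))"
proof -
  interpret prob_space M by fact
  have indep: "indep_vars (\<lambda>_. borel) w UNIV"
    and same: "distr M borel (w i) = distr M borel (w 0)"
    and gaussian: "gaussian_vector M (w i)" "mean_vector M (w i) = 0" "covariance_matrix M (w i) = \<Sigma>\<^sub>w" for i
    using assms(2) by (auto simp: iid_gaussian_noise_def)
  have w[measurable]: "w i \<in> borel_measurable M" for i
    using gaussian(1) by (simp add: gaussian_vector_def)
  obtain a v q where "gaussian_regression M (w 0) a v q"
    using gaussian_regression_exists[OF assms(1) gaussian(1,2), of 0] gaussian(3) assms(3) by auto
  then interpret gaussian_regression M "w 0" a v q .
  \<comment> \<open>By \<open>price_translate\<close> the intercept is moved into the argument: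
    \<open>x\<close> stands for the noise already shifted by \<open>b\<close>, so one function
    serves all parameters.\<close>
  define G where "G t x = price \<mu> (mat 1) 0 (\<lambda>_. 0) x t" for t x
  have G[measurable]: "G t \<in> borel_measurable (\<Pi>\<^sub>M i\<in>{..<t}. borel)" for t
    unfolding G_def by (rule measurable_price) (use assms(4) in auto)
  define P where "P t \<theta> = (\<Pi>\<^sub>M i\<in>{..<t}. law \<theta>)" for t :: nat and \<theta>
  have P: "prob_space (P t \<theta>)" for t \<theta>
    unfolding P_def by (intro prob_space_PiM prob_space_law)
  have sets_P[measurable_cong]: "sets (P t \<theta>) = sets (\<Pi>\<^sub>M i\<in>{..<t}. borel)" for t \<theta>
    unfolding P_def by (rule sets_PiM_cong) simp_all
  define E where "E t \<alpha> r = {x \<in> space (\<Pi>\<^sub>M i\<in>{..<t}. borel). r \<le> norm (\<alpha> *\<^sub>R v - G t x)}" for t \<alpha> r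
  have E[measurable]: "E t \<alpha> r \<in> sets (\<Pi>\<^sub>M i\<in>{..<t}. borel)" for t \<alpha> r
    unfolding E_def by measurable
  have EP: "E t \<alpha> r \<in> sets (P t \<theta>)" for t \<alpha> r \<theta> by (simp add: sets_P)
  define F where "F t \<theta> \<alpha> r = measure (P t \<theta>) (E t \<alpha> r)" for t \<theta> \<alpha> r

  have "\<exists>\<theta>. \<forall>g. 64 ^ g / 8 \<le> (\<Sum>t\<in>{64 ^ g<..2 * 64 ^ g}. F t \<theta> \<theta> (sqrt q * norm v / (16 * 8 ^ g)))"
  proof (rule nested_parameter_exists[of q "norm v" F])
    show "0 < q" by (rule q_pos)
    show "0 \<le> norm v" by simp
    show "\<bar>F t \<theta>' \<alpha> r - F t \<theta> \<alpha> r\<bar> \<le> sqrt (exp (t * (\<theta>' - \<theta>)\<^sup>2 / q) - 1)" for t \<theta> \<theta>' \<alpha> r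
      unfolding F_def P_def using measure_PiM_law_diff_le[of "{..<t}" "E t \<alpha> r" \<theta>' \<theta>] by simp
    show "1 \<le> F t \<theta> \<alpha> r + F t \<theta> \<beta> r" if r: "2 * r \<le> \<bar>\<alpha> - \<beta>\<bar> * norm v" for t \<theta> \<alpha> \<beta> r
    proof -
      interpret P: prob_space "P t \<theta>" by (rule P)
      have "r \<le> norm (\<alpha> *\<^sub>R v - G t x) \<or> r \<le> norm (\<beta> *\<^sub>R v - G t x)" for x
      proof -
        have "norm (\<alpha> *\<^sub>R v - \<beta> *\<^sub>R v) \<le> norm (\<alpha> *\<^sub>R v - G t x) + norm (\<beta> *\<^sub>R v - G t x)"
          using norm_triangle_ineq4[of "\<alpha> *\<^sub>R v - G t x" "\<beta> *\<^sub>R v - G t x"] by simp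
        then show ?thesis using r by (auto simp flip: scaleR_left_diff_distrib)
      qed
      \<comment> \<open>By the triangle inequality the price cannot be closer than \<open>r\<close>
        to both \<open>\<alpha> *\<^sub>R v\<close> and \<open>\<beta> *\<^sub>R v\<close>.\<close>
      then have "space (P t \<theta>) = E t \<alpha> r \<union> E t \<beta> r"
        by (auto simp: E_def sets_eq_imp_space_eq[OF sets_P])
      then have "1 = measure (P t \<theta>) (E t \<alpha> r \<union> E t \<beta> r)"
        using P.prob_space by simp
      also have "\<dots> \<le> F t \<theta> \<alpha> r + F t \<theta> \<beta> r"
        unfolding F_def by (intro measure_Un_le EP)
      finally show ?thesis .
    qed
    show "F t \<theta> \<alpha> r \<le> F t \<theta> \<beta> r'" if r: "r' + \<bar>\<alpha> - \<beta>\<bar> * norm v \<le> r" for t \<theta> \<alpha> \<beta> r r'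
    proof -
      interpret P: prob_space "P t \<theta>" by (rule P)
      have tri: "norm (\<alpha> *\<^sub>R v - G t x) \<le> \<bar>\<alpha> - \<beta>\<bar> * norm v + norm (\<beta> *\<^sub>R v - G t x)" for x
        using norm_triangle_ineq[of "(\<alpha> - \<beta>) *\<^sub>R v" "\<beta> *\<^sub>R v - G t x"]
        unfolding norm_scaleR by (simp add: scaleR_left_diff_distrib)
      have "E t \<alpha> r \<subseteq> E t \<beta> r'"
      proof
        fix x assume "x \<in> E t \<alpha> r"
        then show "x \<in> E t \<beta> r'" using r tri[of x] by (simp add: E_def)
      qed
      then show ?thesis
        unfolding F_def by (intro P.finite_measure_mono EP)
    qed
  qed
  then obtain \<theta> where \<theta>: "\<And>g. 64 ^ g / 8
      \<le> (\<Sum>t\<in>{64 ^ g<..2 * 64 ^ g}. F t \<theta> \<theta> (sqrt q * norm v / (16 * 8 ^ g)))"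
    by blast
  let ?R = "regret M w \<mu> (mat 1) (\<theta> *\<^sub>R v) (\<lambda>_. 0)"

  have law_w: "distr M borel (\<lambda>\<omega>. w i \<omega> + \<theta> *\<^sub>R v) = law \<theta>" for i
  proof -
    have "distr M borel (\<lambda>\<omega>. w i \<omega> + \<theta> *\<^sub>R v) = distr (distr M borel (w i)) borel (\<lambda>x. x + \<theta> *\<^sub>R v)"
      by (subst distr_distr) (auto simp: comp_def)
    also have "\<dots> = law \<theta>"
      unfolding same[of i] law_def by (subst distr_distr) (auto simp: comp_def)
    finally show ?thesis .
  qed
  \<comment> \<open>The product characterisation of independence is applied to a nonempty index set,
    so day 0 is left out; every block starts after day 1.\<close>
  have law_sample: "distr M (\<Pi>\<^sub>M i\<in>{..<t}. borel) (\<lambda>\<omega>. \<lambda>i\<in>{..<t}. w i \<omega> + \<theta> *\<^sub>R v) = P t \<theta>"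
    if "t \<noteq> 0" for t
  proof -
    have "indep_vars (\<lambda>_. borel) (\<lambda>i \<omega>. w i \<omega> + \<theta> *\<^sub>R v) {..<t}"
      using indep_vars_compose2[OF indep_vars_subset[OF indep], of "{..<t}" "\<lambda>_ x. x + \<theta> *\<^sub>R v" "\<lambda>_. borel"]
      by simp
    then show ?thesis
      using that by (subst (asm) indep_vars_iff_distr_eq_PiM) (auto simp: law_w P_def lessThan_empty_iff)
  qed
  \<comment> \<open>Markov's inequality for the squared estimation error.\<close>
  have regret_ge: "ennreal (r\<^sup>2 * F t \<theta> \<theta> r) \<le> ?R t" if "t \<noteq> 0" "0 \<le> r" for t r
  proof -
    interpret P: prob_space "P t \<theta>" by (rule P)
    have "?R t = (\<integral>\<^sup>+\<omega>. ennreal ((norm (\<theta> *\<^sub>R v - G t (\<lambda>i\<in>{..<t}. w i \<omega> + \<theta> *\<^sub>R v)))\<^sup>2) \<partial>M)"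
      unfolding regret_def G_def
      by (subst price_translate, subst price_restrict) simp
    also have "\<dots> = (\<integral>\<^sup>+x. ennreal ((norm (\<theta> *\<^sub>R v - G t x))\<^sup>2) \<partial>P t \<theta>)"
      unfolding law_sample[OF that(1), symmetric]
      by (subst nn_integral_distr) (auto intro!: measurable_restrict)
    also have "\<dots> \<ge> (\<integral>\<^sup>+x. ennreal (r\<^sup>2) * indicator (E t \<theta> r) x \<partial>P t \<theta>)"
      using that(2)
      by (intro nn_integral_mono) (auto simp: E_def indicator_def intro!: ennreal_leI power_mono)
    also have "(\<integral>\<^sup>+x. ennreal (r\<^sup>2) * indicator (E t \<theta> r) x \<partial>P t \<theta>) = ennreal (r\<^sup>2 * F t \<theta> \<theta> r)"
      using EP by (simp add: nn_integral_cmult_indicator F_def P.emeasure_eq_measure ennreal_mult')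
    finally show ?thesis .
  qed
  \<comment> \<open>This is \<open>64 ^ g / 8\<close> times the squared radius
    \<open>(sqrt q * norm v / (16 * 8 ^ g))\<^sup>2\<close>; the powers of \<open>g\<close> cancel
    and \<open>8 * 256 = 2048\<close>.\<close>
  define c where "c = q * (norm v)\<^sup>2 / 2048"
  have c: "0 < c" using q_pos regression_nonzero by (simp add: c_def)
  have blocks: "ennreal c \<le> (\<Sum>t\<in>{64 ^ g<..2 * 64 ^ g}. ?R t)" for g
  proof -
    define r where "r = sqrt q * norm v / (16 * 8 ^ g)"
    have r: "0 \<le> r" using q_pos by (simp add: r_def)
    have "(8 ^ g)\<^sup>2 = (64 ^ g :: real)"
      by (simp add: power2_eq_square flip: power_mult_distrib)
    then have "c = r\<^sup>2 * (64 ^ g / 8)"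
      using q_pos by (simp add: c_def r_def power_divide power_mult_distrib)
    also have "\<dots> \<le> r\<^sup>2 * (\<Sum>t\<in>{64 ^ g<..2 * 64 ^ g}. F t \<theta> \<theta> r)"
      using \<theta>[of g] by (intro mult_left_mono) (auto simp: r_def)
    finally have "ennreal c \<le> ennreal (\<Sum>t\<in>{64 ^ g<..2 * 64 ^ g}. r\<^sup>2 * F t \<theta> \<theta> r)"
      by (intro ennreal_leI) (simp add: sum_distrib_left)
    also have "\<dots> = (\<Sum>t\<in>{64 ^ g<..2 * 64 ^ g}. ennreal (r\<^sup>2 * F t \<theta> \<theta> r))"
      by (simp add: F_def sum_ennreal)
    also have "\<dots> \<le> (\<Sum>t\<in>{64 ^ g<..2 * 64 ^ g}. ?R t)"
      using r by (intro sum_mono regret_ge) auto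
    finally show ?thesis .
  qed
  have "\<forall>T\<ge>2. ennreal (c / ln 128 * ln (real T)) \<le> (\<Sum>t = 1..T. ?R t)"
    using sum_ge_of_geometric_blocks[OF blocks] c by simp
  moreover have "0 < c / ln 128" using c by simp
  ultimately show ?thesis
    using positive_definite_mat_1 by blast
qed

end
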